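(* Fix $\delta>\delta'>1/2$, let $f_0\in L^2$ and let $\Pi$ be a prior on $L^2$ with posterior $\Pi_n=\Pi(\cdot\mid\mathbb X^{(n)})$. Suppose: (i) for every $\varepsilon>0$ there exists a constant $0<M\equiv M(\varepsilon)<\infty$ independent of $n$ such that, for any $n\ge1$, $$E_{f_0}^n\,\Pi\Big[\Big\{f:\|f-f_0\|_{H(\delta')}^2>\frac Mn\Big\}\,\Big|\,\mathbb X^{(n)}\Big]\le\varepsilon;$$ (ii) for every finite-dimensional space $V=\mathrm{span}\{\psi_{lk}:l\in\mathcal L',k\in\mathcal Z_l'\}$ with finite $\mathcal L'\subset\mathcal L$, $\mathcal Z_l'\subset\mathcal Z_l$, as $n\to\infty$, $$\|\Pi_n\circ T_{\mathbb X^{(n)},V}^{-1}-N(0,I)\|_{\mathrm{TV}}\to0\quad\text{in }P_{f_0}^n\text{-probability},$$ where $T_{z,V}(f)=\sqrt n\,\pi_V(f-z)$ and $N(0,I)$ is the standard Gaussian measure on $V$ (with the $L^2$-norm). Let $\beta$ be the bounded Lipschitz metric for weak convergence of probability measures on $H(\delta)$. Then, as $n\to\infty$, $\beta(\Pi_n\circ\tau_{\mathbb X^{(n)}}^{-1},\mathcal N)\to0$ in $P_{f_0}^n$-probability.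
   Context: Basis. $L^2=L^2([0,1])$, $\langle f,g\rangle=\int_0^1 f\bar g$. Let $S\in\mathbb N$. Fix an $S$-regular orthonormal basis $\{\psi_{lk}: l\in\mathcal L,k\in\mathcal Z_l\}$ of $L^2$ ($\mathcal L,\mathcal Z_l\subset\mathbb Z$) with characteristic sequence $a_l$, meaning that every $\psi_{lk}$ is $S$-times differentiable with all derivatives in $L^2$ and either (a) $|\mathcal Z_l|=1$ and $a_l=\max(2,|l|)$, or (b) $\mathcal L\subset\mathbb N=\{1,2,\dots\}$ and $a_l=|\mathcal Z_l|=2^l$. Space $H(\delta)$. For $\delta>1/2$, $H(\delta)$ is the Hilbert space of linear forms $f$ on $\mathrm{span}\{\psi_{lk}\}$ (identified with their coefficients $\langle f,\psi_{lk}\rangle$) with $\|f\|_{H(\delta)}^2=\sum_{l}a_l^{-1}(\log a_l)^{-2\delta}\sum_{k}|\langle f,\psi_{lk}\rangle|^2<\infty$. It contains $L^2$. Standard white noise $\mathbb W$, with i.i.d. $N(0,1)$ coefficients in the basis, is a tight centered Gaussian Borel random variable in $H(\delta)$; its law is $\mathcal N$. $\pi_V$ is the orthogonal projection of $L^2$ onto $V$, extended to $H(\delta)$ by $\pi_V(f)=\sum_{l\in\mathcal L',k\in\mathcal Z_l'}\langle f,\psi_{lk}\rangle\psi_{lk}$. Model. For $f\in L^2$, $P_f^n$ is the law of $\mathbb X^{(n)}=f+n^{-1/2}\mathbb W$ in $H(\delta)$, with expectation $E_f^n$. A prior $\Pi$ is a Borel probability measure on $L^2$; the posterior $\Pi(\cdot\mid\mathbb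 X^{(n)})$ is the conditional law of $f$ given $\mathbb X^{(n)}$ when $f\sim\Pi$, $\mathbb X^{(n)}\mid f\sim P_f^n$ (Bayes' formula with likelihood $dP_f^n/dP_0^n=\exp(n\langle f,\mathbb X^{(n)}\rangle-\tfrac n2\|f\|_2^2)$), also viewed as a Borel measure on $H(\delta)$. Data are generated under $P_{f_0}^n$. Further notation. $\tau_z(f)=\sqrt n(f-z)$ for $f,z\in H(\delta)$; $\beta(\mu,\nu)=\sup_u|\int u\,d(\mu-\nu)|$ over $u:H(\delta)\to\mathbb R$ with $\sup|u|+\mathrm{Lip}(u)\le1$; $\|\cdot\|_{\mathrm{TV}}$ is the total variation norm on finite signed measures on $V$. *)

theory Defs
  imports "HOL-Probability.Probability"
begin

section \<open>The Hilbert space of square-integrable functions on the unit interval\<close>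

text \<open>
  Scalars are real, so the complex conjugate in the inner product disappears.
\<close>

definition square_integrable :: "(real \<Rightarrow> real) \<Rightarrow> bool" where
  "square_integrable f \<longleftrightarrow>
     f \<in> borel_measurable (lebesgue_on {0..1}) \<and>
     integrable (lebesgue_on {0..1}) (\<lambda>x. (f x)\<^sup>2)"

definition L2_eq :: "(real \<Rightarrow> real) \<Rightarrow> (real \<Rightarrow> real) \<Rightarrow> bool" where
  "L2_eq f g \<longleftrightarrow> square_integrable f \<and> square_integrable g \<and>
     (AE x in lebesgue_on {0..1}. f x = g x)"

lemma square_integrable_mult:
  assumes "square_integrable f" "square_integrable g"
  shows "integrable (lebesgue_on {0..1}) (\<lambda>x. f x * g x)"
proof (rule Bochner_Integration.integrable_bound)
  show "integrable (lebesgue_on {0..1}) (\<lambda>x. (f x)\<^sup>2 + (g x)\<^sup>2)"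
    using assms by (auto simp: square_integrable_def)
  show "(\<lambda>x. f x * g x) \<in> borel_measurable (lebesgue_on {0..1})"
    using assms by (auto simp: square_integrable_def)
  have "\<bar>a * b\<bar> \<le> a\<^sup>2 + b\<^sup>2" for a b :: real
  proof -
    have "2 * (\<bar>a\<bar> * \<bar>b\<bar>) \<le> a\<^sup>2 + b\<^sup>2"
      using sum_squares_bound[of "\<bar>a\<bar>" "\<bar>b\<bar>"] by simp
    then show ?thesis
      using mult_nonneg_nonneg[of "\<bar>a\<bar>" "\<bar>b\<bar>"] by (simp only: abs_mult) linarith
  qed
  then show "AE x in lebesgue_on {0..1}. norm (f x * g x) \<le> norm ((f x)\<^sup>2 + (g x)\<^sup>2)"
    by auto
qed

lemma square_integrable_zero: "square_integrable (\<lambda>_. 0)"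
  by (simp add: square_integrable_def)

lemma square_integrable_add:
  assumes "square_integrable f" "square_integrable g"
  shows "square_integrable (\<lambda>x. f x + g x)"
  using assms square_integrable_mult[OF assms]
  by (auto simp: square_integrable_def power2_sum mult.assoc)

lemma square_integrable_scale:
  assumes "square_integrable f"
  shows "square_integrable (\<lambda>x. r * f x)"
  using assms by (auto simp: square_integrable_def power_mult_distrib)

quotient_type L2 = "real \<Rightarrow> real" / partial: L2_eq
proof (rule part_equivpI)
  show "\<exists>f. L2_eq f f"
    using square_integrable_zero by (auto simp: L2_eq_def)
  show "symp L2_eq"
    by (auto simp: symp_def L2_eq_def eq_commute)
  show "transp L2_eq"
    unfolding transp_def L2_eq_def by (auto elim: AE_mp)
qed

instantiation L2 :: real_inner
begin

lift_definition zero_L2 :: L2 is "\<lambda>_. 0"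
  by (simp add: L2_eq_def square_integrable_zero)

lift_definition plus_L2 :: "L2 \<Rightarrow> L2 \<Rightarrow> L2" is "\<lambda>f g x. f x + g x"
  by (auto simp: L2_eq_def intro: square_integrable_add)

lift_definition scaleR_L2 :: "real \<Rightarrow> L2 \<Rightarrow> L2" is "\<lambda>r f x. r * f x"
  by (auto simp: L2_eq_def intro: square_integrable_scale)

definition uminus_L2 :: "L2 \<Rightarrow> L2" where "uminus_L2 f = (-1) *\<^sub>R f"

definition minus_L2 :: "L2 \<Rightarrow> L2 \<Rightarrow> L2" where "minus_L2 f g = f + - g"

lift_definition inner_L2 :: "L2 \<Rightarrow> L2 \<Rightarrow> real" is
  "\<lambda>f g. \<integral>x. f x * g x \<partial>lebesgue_on {0..1}"
  unfolding L2_eq_def square_integrable_def by (intro integral_cong_AE) auto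

definition norm_L2 :: "L2 \<Rightarrow> real" where "norm_L2 f = sqrt (inner f f)"

definition sgn_L2 :: "L2 \<Rightarrow> L2" where "sgn_L2 f = inverse (norm f) *\<^sub>R f"

definition dist_L2 :: "L2 \<Rightarrow> L2 \<Rightarrow> real" where "dist_L2 f g = norm (f - g)"

definition uniformity_L2 :: "(L2 \<times> L2) filter" where
  "uniformity_L2 = (INF e\<in>{0<..}. principal {(x, y). dist x y < e})"

definition open_L2 :: "L2 set \<Rightarrow> bool" where
  "open_L2 U \<longleftrightarrow> (\<forall>x\<in>U. \<forall>\<^sub>F (x', y) in uniformity. x' = x \<longrightarrow> y \<in> U)"

instance
proof
  fix f g h :: L2 and r s :: real and U :: "L2 set"
  show "f + g + h = f + (g + h)"
    by transfer (auto simp: L2_eq_def add.assoc intro!: square_integrable_add)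
  show "f + g = g + f"
    by transfer (auto simp: L2_eq_def add.commute intro!: square_integrable_add)
  show "0 + f = f"
    by transfer (auto simp: L2_eq_def)
  show "- f + f = 0"
    unfolding uminus_L2_def
    by transfer (auto simp: L2_eq_def intro!: square_integrable_zero)
  show "f - g = f + - g"
    by (rule minus_L2_def)
  show "r *\<^sub>R (f + g) = r *\<^sub>R f + r *\<^sub>R g"
    by transfer (auto simp: L2_eq_def distrib_left
        intro!: square_integrable_add square_integrable_scale)
  show "(r + s) *\<^sub>R f = r *\<^sub>R f + s *\<^sub>R f"
    by transfer (auto simp: L2_eq_def distrib_right
        intro!: square_integrable_add square_integrable_scale)
  show "r *\<^sub>R s *\<^sub>R f = (r * s) *\<^sub>R f"
    by transfer (auto simp: L2_eq_def mult.assoc intro!: square_integrable_scale)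
  show "1 *\<^sub>R f = f"
    by transfer (auto simp: L2_eq_def)
  show "dist f g = norm (f - g)"
    by (rule dist_L2_def)
  show "sgn f = inverse (norm f) *\<^sub>R f"
    by (rule sgn_L2_def)
  show "uniformity = (INF e\<in>{0<..}. principal {(x, y :: L2). dist x y < e})"
    by (rule uniformity_L2_def)
  show "open U \<longleftrightarrow> (\<forall>x\<in>U. \<forall>\<^sub>F (x', y) in uniformity. x' = x \<longrightarrow> y \<in> U)"
    by (rule open_L2_def)
  show "inner f g = inner g f"
    by transfer (simp add: mult.commute)
  show "inner (f + g) h = inner f h + inner g h"
    by transfer (auto simp: L2_eq_def distrib_right intro!: Bochner_Integration.integral_add
        square_integrable_mult)
  show "inner (r *\<^sub>R f) g = r * inner f g"
    by transfer (auto simp: mult.assoc)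
  show "0 \<le> inner f f"
    by transfer simp
  show "inner f f = 0 \<longleftrightarrow> f = 0"
  proof transfer
    fix f assume "L2_eq f f"
    then have f: "square_integrable f" by (simp add: L2_eq_def)
    have "(\<integral>x. f x * f x \<partial>lebesgue_on {0..1}) = 0 \<longleftrightarrow>
        (AE x in lebesgue_on {0..1}. f x * f x = 0)"
      by (rule integral_nonneg_eq_0_iff_AE) (auto intro: square_integrable_mult[OF f f])
    then show "(\<integral>x. f x * f x \<partial>lebesgue_on {0..1}) = 0 \<longleftrightarrow> L2_eq f (\<lambda>_. 0)"
      using f by (simp add: L2_eq_def square_integrable_zero)
  qed
  show "norm f = sqrt (inner f f)"
    by (rule norm_L2_def)
qed

end

text \<open>
  The class of a function; meaningful only for square-integrable arguments.
\<close>

definition to_L2 :: "(real \<Rightarrow> real) \<Rightarrow> L2" where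
  "to_L2 = abs_L2"


section \<open>Regular orthonormal bases\<close>

text \<open>
  The derivatives at the endpoints of the interval are one-sided.
\<close>

definition times_differentiable_L2 :: "nat \<Rightarrow> (real \<Rightarrow> real) \<Rightarrow> bool" where
  "times_differentiable_L2 S f \<longleftrightarrow>
     (\<exists>D :: nat \<Rightarrow> real \<Rightarrow> real.
        D 0 = f \<and>
        (\<forall>m<S. \<forall>x\<in>{0..1}. (D m has_real_derivative D (Suc m) x) (at x within {0..1})) \<and>
        (\<forall>m\<le>S. square_integrable (D m)))"

abbreviation basis_vec :: "(int \<Rightarrow> int \<Rightarrow> real \<Rightarrow> real) \<Rightarrow> int \<times> int \<Rightarrow> L2" where
  "basis_vec \<psi> \<equiv> \<lambda>(l, k). to_L2 (\<psi> l k)"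

definition orthonormal_basis :: "(int \<times> int) set \<Rightarrow> (int \<times> int \<Rightarrow> L2) \<Rightarrow> bool" where
  "orthonormal_basis I e \<longleftrightarrow>
     (\<forall>i\<in>I. \<forall>j\<in>I. inner (e i) (e j) = (if i = j then 1 else 0)) \<and>
     closure (span (e ` I)) = UNIV"

definition regular_basis ::
  "nat \<Rightarrow> int set \<Rightarrow> (int \<Rightarrow> int set) \<Rightarrow> (int \<Rightarrow> int \<Rightarrow> real \<Rightarrow> real) \<Rightarrow> (int \<Rightarrow> real) \<Rightarrow> bool"
where
  "regular_basis S L Z \<psi> a \<longleftrightarrow>
     (\<forall>l\<in>L. \<forall>k\<in>Z l. times_differentiable_L2 S (\<psi> l k)) \<and>
     orthonormal_basis (Sigma L Z) (basis_vec \<psi>) \<and>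
     ((\<forall>l\<in>L. card (Z l) = 1 \<and> a l = real_of_int (max 2 \<bar>l\<bar>)) \<or>
      (L \<subseteq> {1..} \<and> (\<forall>l\<in>L. a l = real (card (Z l)) \<and> card (Z l) = 2 ^ nat l)))"


section \<open>The spaces H\<close>

text \<open>
  A linear form on the span of the basis is represented by its family of coefficients, a function
  on pairs \<open>(l, k)\<close> that is \<open>undefined\<close> outside the index set \<open>Sigma L Z\<close>.
\<close>

definition norm_H ::
  "int set \<Rightarrow> (int \<Rightarrow> int set) \<Rightarrow> (int \<Rightarrow> real) \<Rightarrow> real \<Rightarrow> (int \<times> int \<Rightarrow> real) \<Rightarrow> real"
where
  "norm_H L Z a \<delta> c =
     sqrt (\<Sum>\<^sub>\<infinity>l\<in>L. inverse (a l) * ln (a l) powr (-2 * \<delta>) * (\<Sum>k\<in>Z l. \<bar>c (l, k)\<bar>\<^sup>2))"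

definition space_H ::
  "int set \<Rightarrow> (int \<Rightarrow> int set) \<Rightarrow> (int \<Rightarrow> real) \<Rightarrow> real \<Rightarrow> (int \<times> int \<Rightarrow> real) set"
where
  "space_H L Z a \<delta> =
     {c \<in> extensional (Sigma L Z).
        (\<lambda>l. inverse (a l) * ln (a l) powr (-2 * \<delta>) * (\<Sum>k\<in>Z l. \<bar>c (l, k)\<bar>\<^sup>2)) summable_on L}"

definition dist_H ::
  "int set \<Rightarrow> (int \<Rightarrow> int set) \<Rightarrow> (int \<Rightarrow> real) \<Rightarrow> real \<Rightarrow>
   (int \<times> int \<Rightarrow> real) \<Rightarrow> (int \<times> int \<Rightarrow> real) \<Rightarrow> real"
where
  "dist_H L Z a \<delta> x y = norm_H L Z a \<delta> (\<lambda>i. x i - y i)"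

lemma Metric_space_H:
  assumes "\<And>l. l \<in> L \<Longrightarrow> a l > 1" and fin: "\<And>l. l \<in> L \<Longrightarrow> finite (Z l)"
  shows "Metric_space (space_H L Z a \<delta>) (dist_H L Z a \<delta>)"
proof -
  define w where "w l = inverse (a l) * ln (a l) powr (-2 * \<delta>)" for l
  define q where "q c l = w l * (\<Sum>k\<in>Z l. \<bar>c (l, k)\<bar>\<^sup>2)" for c :: "int \<times> int \<Rightarrow> real" and l
  have w: "w l > 0" if "l \<in> L" for l
    using assms(1)[OF that] by (auto simp: w_def)
  have q0: "q c l \<ge> 0" if "l \<in> L" for c l
    unfolding q_def using w[OF that] by (intro mult_nonneg_nonneg sum_nonneg) auto
  have norm: "norm_H L Z a \<delta> c = sqrt (infsum (q c) L)" for c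
    unfolding norm_H_def q_def[abs_def] w_def ..
  have H: "c \<in> space_H L Z a \<delta> \<longleftrightarrow> c \<in> extensional (Sigma L Z) \<and> q c summable_on L" for c
    unfolding space_H_def q_def[abs_def] w_def by simp
  have norm0: "norm_H L Z a \<delta> c \<ge> 0" for c
    unfolding norm by (auto intro!: infsum_nonneg q0)
  have le_norm: "sqrt (sum (q c) F) \<le> norm_H L Z a \<delta> c"
    if "q c summable_on L" "finite F" "F \<subseteq> L" for c F
    unfolding norm using that by (intro real_sqrt_le_mono finite_sum_le_infsum) (auto intro: q0)
  have L2: "sqrt (sum (q c) F) = L2_set (\<lambda>(l, k). sqrt (w l) * c (l, k)) (Sigma F Z)"
    if "finite F" "F \<subseteq> L" for c F
  proof -
    have "sum (q c) F = (\<Sum>l\<in>F. \<Sum>k\<in>Z l. (sqrt (w l) * c (l, k))\<^sup>2)"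
      using that w by (intro sum.cong)
        (auto simp: q_def sum_distrib_left power_mult_distrib less_imp_le subset_iff)
    also have "\<dots> = (\<Sum>(l, k)\<in>Sigma F Z. (sqrt (w l) * c (l, k))\<^sup>2)"
      using that fin by (intro sum.Sigma) auto
    finally show ?thesis
      unfolding L2_set_def by (simp add: case_prod_unfold)
  qed
  have tri: "q (\<lambda>i. x i + y i) summable_on L \<and>
      norm_H L Z a \<delta> (\<lambda>i. x i + y i) \<le> norm_H L Z a \<delta> x + norm_H L Z a \<delta> y"
    if x: "q x summable_on L" and y: "q y summable_on L" for x y
  proof -
    let ?B = "norm_H L Z a \<delta> x + norm_H L Z a \<delta> y"
    have bd: "sum (q (\<lambda>i. x i + y i)) F \<le> ?B\<^sup>2" if F: "finite F" "F \<subseteq> L" for F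
    proof -
      have "sqrt (sum (q (\<lambda>i. x i + y i)) F) =
          L2_set (\<lambda>i. (case i of (l, k) \<Rightarrow> sqrt (w l) * x (l, k)) +
                      (case i of (l, k) \<Rightarrow> sqrt (w l) * y (l, k))) (Sigma F Z)"
        unfolding L2[OF F] by (intro L2_set_cong) (auto simp: distrib_left)
      also have "\<dots> \<le> sqrt (sum (q x) F) + sqrt (sum (q y) F)"
        unfolding L2[OF F] by (rule L2_set_triangle_ineq)
      also have "\<dots> \<le> ?B"
        using le_norm[OF x F] le_norm[OF y F] by linarith
      finally show ?thesis
        by (rule sqrt_le_D)
    qed
    have s: "q (\<lambda>i. x i + y i) summable_on L"
      using bd by (intro nonneg_bdd_above_summable_on q0) (auto simp: bdd_above_def)
    have "infsum (q (\<lambda>i. x i + y i)) L \<le> ?B\<^sup>2"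
      using s bd by (intro infsum_le_finite_sums) auto
    then have "norm_H L Z a \<delta> (\<lambda>i. x i + y i) \<le> sqrt (?B\<^sup>2)"
      unfolding norm by (rule real_sqrt_le_mono)
    with s show ?thesis
      using norm0[of x] norm0[of y] by simp
  qed
  have neg: "q (\<lambda>i. - x i) = q x" for x
    by (auto simp: q_def)
  have diff: "q (\<lambda>i. x i - y i) summable_on L"
    if "q x summable_on L" "q y summable_on L" for x y
    using tri[of x "\<lambda>i. - y i"] that by (simp add: neg)
  show ?thesis
  proof
    fix x y z
    show "0 \<le> dist_H L Z a \<delta> x y"
      by (simp add: dist_H_def norm0)
    have "q (\<lambda>i. x i - y i) = q (\<lambda>i. y i - x i)"
      by (auto simp: q_def power2_commute)
    then show "dist_H L Z a \<delta> x y = dist_H L Z a \<delta> y x"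
      by (simp add: dist_H_def norm)
    show "dist_H L Z a \<delta> x y = 0 \<longleftrightarrow> x = y"
      if xy: "x \<in> space_H L Z a \<delta>" "y \<in> space_H L Z a \<delta>"
    proof
      assume "dist_H L Z a \<delta> x y = 0"
      then have 0: "infsum (q (\<lambda>i. x i - y i)) L = 0"
        by (simp add: dist_H_def norm)
      have s: "q (\<lambda>i. x i - y i) summable_on L"
        using xy by (intro diff) (auto simp: H)
      have "x (l, k) = y (l, k)" if l: "l \<in> L" "k \<in> Z l" for l k
      proof -
        have "q (\<lambda>i. x i - y i) l \<le> 0"
          using finite_sum_le_infsum[OF s, of "{l}"] q0 l 0 by simp
        with w[OF l(1)] have "(\<Sum>k\<in>Z l. \<bar>x (l, k) - y (l, k)\<bar>\<^sup>2) \<le> 0"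
          by (simp add: q_def mult_le_0_iff)
        then have "(\<Sum>k\<in>Z l. \<bar>x (l, k) - y (l, k)\<bar>\<^sup>2) = 0"
          by (intro antisym sum_nonneg) auto
        then show ?thesis
          using fin[OF l(1)] l(2) by (subst (asm) sum_nonneg_eq_0_iff) auto
      qed
      then show "x = y"
        using xy by (intro extensionalityI[of x "Sigma L Z" y]) (auto simp: H)
    next
      assume "x = y"
      then show "dist_H L Z a \<delta> x y = 0"
        by (simp add: dist_H_def norm_H_def)
    qed
    show "dist_H L Z a \<delta> x z \<le> dist_H L Z a \<delta> x y + dist_H L Z a \<delta> y z"
      if "x \<in> space_H L Z a \<delta>" "y \<in> space_H L Z a \<delta>" "z \<in> space_H L Z a \<delta>"
    proof -
      have "q (\<lambda>i. x i - y i) summable_on L" "q (\<lambda>i. y i - z i) summable_on L"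
        using that by (auto intro!: diff simp: H)
      from conjunct2[OF tri[OF this]] show ?thesis
        by (simp add: dist_H_def)
    qed
  qed
qed

lemma Metric_space_H_regular_basis:
  assumes "regular_basis S L Z \<psi> a"
  shows "Metric_space (space_H L Z a \<delta>) (dist_H L Z a \<delta>)"
proof (rule Metric_space_H)
  fix l assume l: "l \<in> L"
  have "a l = real_of_int (max 2 \<bar>l\<bar>) \<and> card (Z l) = 1 \<or>
      1 \<le> l \<and> a l = 2 ^ nat l \<and> card (Z l) = 2 ^ nat l"
    using assms l by (auto simp: regular_basis_def)
  then show "a l > 1" "finite (Z l)"
    using card_ge_0_finite[of "Z l"] by auto
qed

definition borel_H ::
  "int set \<Rightarrow> (int \<Rightarrow> int set) \<Rightarrow> (int \<Rightarrow> real) \<Rightarrow> real \<Rightarrow> (int \<times> int \<Rightarrow> real) measure"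
where
  "borel_H L Z a \<delta> =
     sigma (space_H L Z a \<delta>)
       {U. openin (Metric_space.mtopology (space_H L Z a \<delta>) (dist_H L Z a \<delta>)) U}"

text \<open>
  The embedding of \<open>L2\<close> into the spaces H.
\<close>

definition coeffs_L2 ::
  "int set \<Rightarrow> (int \<Rightarrow> int set) \<Rightarrow> (int \<Rightarrow> int \<Rightarrow> real \<Rightarrow> real) \<Rightarrow> L2 \<Rightarrow> int \<times> int \<Rightarrow> real"
where
  "coeffs_L2 L Z \<psi> f = (\<lambda>i\<in>Sigma L Z. inner f (basis_vec \<psi> i))"


section \<open>White noise, observations and posterior\<close>

text \<open>
  The law of a family of independent standard normal coefficients is the product measure; white
  noise in H is its trace on H, a set of product measure one.
\<close>

definition white_noise ::
  "int set \<Rightarrow> (int \<Rightarrow> int set) \<Rightarrow> (int \<Rightarrow> real) \<Rightarrow> real \<Rightarrow> (int \<times> int \<Rightarrow> real) measure"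
where
  "white_noise L Z a \<delta> =
     distr (restrict_space (PiM (Sigma L Z) (\<lambda>_. std_normal_distribution)) (space_H L Z a \<delta>))
       (borel_H L Z a \<delta>) (\<lambda>w. w)"

definition data_law ::
  "int set \<Rightarrow> (int \<Rightarrow> int set) \<Rightarrow> (int \<Rightarrow> int \<Rightarrow> real \<Rightarrow> real) \<Rightarrow> (int \<Rightarrow> real) \<Rightarrow> real \<Rightarrow>
   nat \<Rightarrow> L2 \<Rightarrow> (int \<times> int \<Rightarrow> real) measure"
where
  "data_law L Z \<psi> a \<delta> n f =
     distr (white_noise L Z a \<delta>) (borel_H L Z a \<delta>)
       (\<lambda>w. \<lambda>i\<in>Sigma L Z. coeffs_L2 L Z \<psi> f i + w i / sqrt (real n))"

text \<open>
  A posterior is a version of the regular conditional law of \<open>f\<close> given the observation, where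
  \<open>f\<close> has law \<open>\<mu>\<close> and the observation given \<open>f\<close> has law \<open>data_law L Z \<psi> a \<delta> n f\<close>: for the
  joint law and all Borel sets \<open>A\<close>, \<open>B\<close>, the probability of \<open>f \<in> A\<close>, \<open>x \<in> B\<close> is the expectation of
  \<open>indicator B x * K x A\<close>. The laws of the observation for different \<open>f\<close> are mutually absolutely
  continuous, so any two versions (Bayes' formula giving one of them) agree almost surely
  under each of these laws.
\<close>

definition is_posterior ::
  "int set \<Rightarrow> (int \<Rightarrow> int set) \<Rightarrow> (int \<Rightarrow> int \<Rightarrow> real \<Rightarrow> real) \<Rightarrow> (int \<Rightarrow> real) \<Rightarrow> real \<Rightarrow>
   L2 measure \<Rightarrow> nat \<Rightarrow> ((int \<times> int \<Rightarrow> real) \<Rightarrow> L2 measure) \<Rightarrow> bool"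
where
  "is_posterior L Z \<psi> a \<delta> \<mu> n K \<longleftrightarrow>
     K \<in> borel_H L Z a \<delta> \<rightarrow>\<^sub>M prob_algebra borel \<and>
     (\<forall>A\<in>sets borel. \<forall>B\<in>sets (borel_H L Z a \<delta>).
        (\<integral>\<^sup>+f\<in>A. emeasure (data_law L Z \<psi> a \<delta> n f) B \<partial>\<mu>) =
        (\<integral>\<^sup>+f. (\<integral>\<^sup>+x\<in>B. emeasure (K x) A \<partial>data_law L Z \<psi> a \<delta> n f) \<partial>\<mu>))"

definition tau ::
  "int set \<Rightarrow> (int \<Rightarrow> int set) \<Rightarrow> nat \<Rightarrow> (int \<times> int \<Rightarrow> real) \<Rightarrow> (int \<times> int \<Rightarrow> real) \<Rightarrow>
   int \<times> int \<Rightarrow> real"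
where
  "tau L Z n z f = (\<lambda>i\<in>Sigma L Z. sqrt (real n) * (f i - z i))"


section \<open>Finite-dimensional projections\<close>

definition subspace_V :: "int set \<Rightarrow> (int \<Rightarrow> int set) \<Rightarrow> (int \<Rightarrow> int \<Rightarrow> real \<Rightarrow> real) \<Rightarrow> L2 set" where
  "subspace_V L' Z' \<psi> = span (basis_vec \<psi> ` Sigma L' Z')"

definition proj_V ::
  "int set \<Rightarrow> (int \<Rightarrow> int set) \<Rightarrow> (int \<Rightarrow> int \<Rightarrow> real \<Rightarrow> real) \<Rightarrow> (int \<times> int \<Rightarrow> real) \<Rightarrow> L2"
where
  "proj_V L' Z' \<psi> c = (\<Sum>i\<in>Sigma L' Z'. c i *\<^sub>R basis_vec \<psi> i)"

definition borel_V :: "int set \<Rightarrow> (int \<Rightarrow> int set) \<Rightarrow> (int \<Rightarrow> int \<Rightarrow> real \<Rightarrow> real) \<Rightarrow> L2 measure" where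
  "borel_V L' Z' \<psi> = restrict_space borel (subspace_V L' Z' \<psi>)"

definition T_V ::
  "int set \<Rightarrow> (int \<Rightarrow> int set) \<Rightarrow> int set \<Rightarrow> (int \<Rightarrow> int set) \<Rightarrow> (int \<Rightarrow> int \<Rightarrow> real \<Rightarrow> real) \<Rightarrow> nat \<Rightarrow>
   (int \<times> int \<Rightarrow> real) \<Rightarrow> L2 \<Rightarrow> L2"
where
  "T_V L Z L' Z' \<psi> n z f =
     sqrt (real n) *\<^sub>R proj_V L' Z' \<psi> (\<lambda>i. coeffs_L2 L Z \<psi> f i - z i)"

definition gaussian_V :: "int set \<Rightarrow> (int \<Rightarrow> int set) \<Rightarrow> (int \<Rightarrow> int \<Rightarrow> real \<Rightarrow> real) \<Rightarrow> L2 measure" where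
  "gaussian_V L' Z' \<psi> =
     distr (PiM (Sigma L' Z') (\<lambda>_. std_normal_distribution)) (borel_V L' Z' \<psi>) (proj_V L' Z' \<psi>)"


section \<open>Distances between measures and convergence in probability\<close>

text \<open>
  The total variation norm of the signed measure \<open>M - N\<close>, that is, the total mass of its variation
  (no factor 1/2).
\<close>

definition tv_dist :: "'a measure \<Rightarrow> 'a measure \<Rightarrow> real" where
  "tv_dist M N =
     (SUP C\<in>{C. finite C \<and> C \<subseteq> sets M \<and> partition_on (space M) C}.
        \<Sum>A\<in>C. \<bar>measure M A - measure N A\<bar>)"

definition BL1_H ::
  "int set \<Rightarrow> (int \<Rightarrow> int set) \<Rightarrow> (int \<Rightarrow> real) \<Rightarrow> real \<Rightarrow> ((int \<times> int \<Rightarrow> real) \<Rightarrow> real) set"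
where
  "BL1_H L Z a \<delta> =
     {u. \<exists>s t. 0 \<le> s \<and> 0 \<le> t \<and> s + t \<le> 1 \<and>
           (\<forall>x\<in>space_H L Z a \<delta>. \<bar>u x\<bar> \<le> s) \<and>
           (\<forall>x\<in>space_H L Z a \<delta>. \<forall>y\<in>space_H L Z a \<delta>. \<bar>u x - u y\<bar> \<le> t * dist_H L Z a \<delta> x y)}"

definition beta_H ::
  "int set \<Rightarrow> (int \<Rightarrow> int set) \<Rightarrow> (int \<Rightarrow> real) \<Rightarrow> real \<Rightarrow>
   (int \<times> int \<Rightarrow> real) measure \<Rightarrow> (int \<times> int \<Rightarrow> real) measure \<Rightarrow> real"
where
  "beta_H L Z a \<delta> M N =
     (SUP u\<in>BL1_H L Z a \<delta>. \<bar>(\<integral>x. u x \<partial>M) - (\<integral>x. u x \<partial>N)\<bar>)"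

text \<open>
  The outer measure makes the definition meaningful without a measurability side condition (the
  library assigns measure zero to non-measurable sets); for measurable \<open>Y\<close> this is ordinary
  convergence in probability.
\<close>

definition tendsto_zero_in_prob :: "(nat \<Rightarrow> 'a measure) \<Rightarrow> (nat \<Rightarrow> 'a \<Rightarrow> real) \<Rightarrow> bool" where
  "tendsto_zero_in_prob P Y \<longleftrightarrow>
     (\<forall>\<epsilon>>0. (\<lambda>n. outer_measure_of (P n) {x \<in> space (P n). \<epsilon> < \<bar>Y n x\<bar>}) \<longlonglongrightarrow> 0)"

end

theory Submission
  imports Defs
begin

text \<open>
  A bounded Lipschitz test function on the space with exponent \<open>\<delta>\<close> changes little when its argument
  is replaced by the truncation to the finitely many levels \<open>\<bar>l\<bar> \<le> m\<close>: on a ball of the stronger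
  norm with exponent \<open>\<delta>' < \<delta>\<close> the truncation error is at most a multiple of
  \<open>(ln (m + 1)) powr (\<delta>' - \<delta>)\<close>, uniformly. White noise puts little mass outside a large such ball,
  as its expected squared norm \<open>\<Sum>l. card (Z l) / (a l * (ln (a l)) powr (2 * \<delta>'))\<close> is finite; the
  rescaled posterior does so by the contraction hypothesis, because its centre differs from the
  true function by \<open>n powr (- 1/2)\<close> times white noise. For the truncations, integrals of test functions
  are compared by the total variation distance on a finite-dimensional subspace.
\<close>

section \<open>The scale of weighted coefficient norms\<close>

text \<open>Total variation on subspaces is what makes the estimate uniform over test functions: a
  truncated test function is a measurable function on the subspace bounded by 1, so one number
  serves the whole bounded Lipschitz class. The order of choices matters: accuracy and probability
  fix the radius of the ball, the radius fixes the truncation level, and only then does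
  \<open>n\<close> grow, so that a single subspace is involved. Measurability is the main obstacle.
  The distance under study is a supremum over uncountably many functions, and its measurability in
  the data is not established; its exceptional set is covered by three measurable sets, which is all
  that an outer measure asks for. On the side of the space, Borel sets come from a metric topology
  whereas white noise is built from coefficients; a countable dense set of rational, finitely
  supported families reconciles the two. Squared norms are extended reals, since the real-valued
  norm cannot detect that a family lies outside the space.\<close>

lemma summable_bertrand:
  assumes "d > 1/2"
  shows "summable (\<lambda>n. inverse (max 2 (real n)) * ln (max 2 (real n)) powr (-2 * d))"
proof (subst condensation_test)
  fix m :: nat
  have "ln (max 2 (real (Suc m))) powr (-2 * d) \<le> ln (max 2 (real m)) powr (-2 * d)"
    using assms by (intro powr_mono2') (auto intro!: ln_mono)
  then show "inverse (max 2 (real (Suc m))) * ln (max 2 (real (Suc m))) powr (-2 * d)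
      \<le> inverse (max 2 (real m)) * ln (max 2 (real m)) powr (-2 * d)"
    by (intro mult_mono le_imp_inverse_le) auto
next
  \<comment> \<open>Condensation leaves the powers \<open>(n * ln 2) powr (-2 * d)\<close>, summable
    because \<open>2 * d > 1\<close>. At \<open>n = 0\<close> the cut-off \<open>max 2\<close> is
    active, so the terms agree only eventually.\<close>
  have "summable (\<lambda>n. ln 2 powr (-2 * d) * real n powr (-2 * d))"
    using assms by (intro summable_mult) (subst summable_real_powr_iff, simp)
  then show "summable (\<lambda>n. 2 ^ n *
      (inverse (max 2 (real (2 ^ n))) * ln (max 2 (real (2 ^ n))) powr (-2 * d)))"
  proof (rule summable_cong[THEN iffD1, rotated])
    show "\<forall>\<^sub>F n in sequentially. ln 2 powr (-2 * d) * real n powr (-2 * d) =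
        2 ^ n * (inverse (max 2 (real (2 ^ n))) * ln (max 2 (real (2 ^ n))) powr (-2 * d))"
      using eventually_ge_at_top[of 1]
    proof eventually_elim
      fix n :: nat assume "1 \<le> n"
      then have "(2::real) ^ 1 \<le> 2 ^ n" by (intro power_increasing) auto
      then have "max 2 (real (2 ^ n)) = 2 ^ n" by simp
      then show "ln 2 powr (-2 * d) * real n powr (-2 * d) =
        2 ^ n * (inverse (max 2 (real (2 ^ n))) * ln (max 2 (real (2 ^ n))) powr (-2 * d))"
        by (simp add: ln_realpow powr_mult mult.commute)
    qed
  qed
qed auto

text \<open>Reduces two-sided sums to one-sided series. The index 0 is counted twice, hence an
  inequality.\<close>

lemma sum_split_sign:
  fixes g :: "int \<Rightarrow> real"
  assumes "\<And>l. g l \<ge> 0"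
  shows "sum g {- int m..int m} \<le> (\<Sum>n\<le>m. g (int n)) + (\<Sum>n\<le>m. g (- int n))"
proof -
  have "sum g {- int m..int m} \<le> sum g ((int ` {..m}) \<union> ((\<lambda>n. - int n) ` {..m}))"
  proof (intro sum_mono2)
    show "{- int m..int m} \<subseteq> int ` {..m} \<union> (\<lambda>n. - int n) ` {..m}"
    proof
      fix x assume x: "x \<in> {- int m..int m}"
      show "x \<in> int ` {..m} \<union> (\<lambda>n. - int n) ` {..m}"
        using x by (cases "0 \<le> x") (auto intro!: image_eqI[of _ _ "nat \<bar>x\<bar>"])
    qed
  qed (use assms in auto)
  also have "\<dots> \<le> sum g (int ` {..m}) + sum g ((\<lambda>n. - int n) ` {..m})"
    by (subst sum_Un) (auto intro!: sum_nonneg assms)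
  also have "\<dots> = (\<Sum>n\<le>m. g (int n)) + (\<Sum>n\<le>m. g (- int n))"
    by (simp add: sum.reindex inj_on_def)
  finally show ?thesis .
qed

definition wt :: "(int \<Rightarrow> real) \<Rightarrow> real \<Rightarrow> int \<Rightarrow> real" where
  "wt a d l = inverse (a l) * ln (a l) powr (-2 * d)"

text \<open>The common content of the two alternatives for \<open>a\<close> and \<open>Z\<close>.
  \<open>a_ge_abs\<close> makes distant levels light, which drives the truncation error to zero;
  \<open>trace_class\<close> says that the diagonal operator with entries \<open>wt a d l\<close>
  has finite trace, which is the expected squared norm of white noise.\<close>

locale H_scale =
  fixes L :: "int set" and Z :: "int \<Rightarrow> int set" and a :: "int \<Rightarrow> real"
  assumes finite_Z: "\<And>l. l \<in> L \<Longrightarrow> finite (Z l)"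
    and a_ge_2: "\<And>l. l \<in> L \<Longrightarrow> 2 \<le> a l"
    and a_ge_abs: "\<And>l. l \<in> L \<Longrightarrow> real_of_int \<bar>l\<bar> \<le> a l"
    and trace_class: "\<And>d. d > 1/2 \<Longrightarrow>
      \<exists>C. \<forall>m. (\<Sum>l\<in>L \<inter> {- int m..int m}. wt a d l * real (card (Z l))) \<le> C"

text \<open>With one vector per level the trace is bounded by a two-sided Bertrand series. With
  \<open>2 ^ nat l\<close> vectors the cardinality cancels \<open>inverse (a l)\<close>, and the
  logarithm leaves a multiple of \<open>l powr (-2 * d)\<close>. Both series converge for
  \<open>d > 1/2\<close>.\<close>

lemma H_scale_regular_basis:
  assumes "regular_basis S L Z \<psi> a"
  shows "H_scale L Z a"
proof
  have ab: "(\<forall>l\<in>L. card (Z l) = 1 \<and> a l = real_of_int (max 2 \<bar>l\<bar>)) \<or>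
      (L \<subseteq> {1..} \<and> (\<forall>l\<in>L. a l = real (card (Z l)) \<and> card (Z l) = 2 ^ nat l))"
    using assms by (simp add: regular_basis_def)
  have pow: "2 \<le> (2::real) ^ nat l \<and> real_of_int l \<le> 2 ^ nat l" if "1 \<le> l" for l
  proof -
    have "(2::real) ^ 1 \<le> 2 ^ nat l" using that by (intro power_increasing) auto
    moreover have "real (nat l) \<le> 2 ^ nat l"
      using of_nat_less_two_power[of "nat l", where 'a=real] by linarith
    ultimately show ?thesis using that by simp
  qed
  fix l assume "l \<in> L"
  with ab pow[of l] show "finite (Z l)" "2 \<le> a l" "real_of_int \<bar>l\<bar> \<le> a l"
    using card_ge_0_finite[of "Z l"] by (auto simp: subset_iff)
next
  have ab: "(\<forall>l\<in>L. card (Z l) = 1 \<and> a l = real_of_int (max 2 \<bar>l\<bar>)) \<or>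
      (L \<subseteq> {1..} \<and> (\<forall>l\<in>L. a l = real (card (Z l)) \<and> card (Z l) = 2 ^ nat l))"
    using assms by (simp add: regular_basis_def)
  fix d :: real assume d: "d > 1/2"
  show "\<exists>C. \<forall>m. (\<Sum>l\<in>L \<inter> {- int m..int m}. wt a d l * real (card (Z l))) \<le> C"
    using ab
  proof
    assume A: "\<forall>l\<in>L. card (Z l) = 1 \<and> a l = real_of_int (max 2 \<bar>l\<bar>)"
    define f where "f n = inverse (max 2 (real n)) * ln (max 2 (real n)) powr (-2 * d)" for n
    have f: "summable f" unfolding f_def by (rule summable_bertrand[OF d])
    have f0: "f n \<ge> 0" for n by (auto simp: f_def)
    have "(\<Sum>l\<in>L \<inter> {- int m..int m}. wt a d l * real (card (Z l))) \<le> 2 * suminf f" for m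
    proof -
      have "(\<Sum>l\<in>L \<inter> {- int m..int m}. wt a d l * real (card (Z l))) =
          (\<Sum>l\<in>L \<inter> {- int m..int m}. f (nat \<bar>l\<bar>))"
        using A by (intro sum.cong) (auto simp: wt_def f_def of_int_max)
      also have "\<dots> \<le> (\<Sum>l\<in>{- int m..int m}. f (nat \<bar>l\<bar>))"
        by (intro sum_mono2) (auto simp: f0)
      also have "\<dots> \<le> (\<Sum>n\<le>m. f n) + (\<Sum>n\<le>m. f n)"
        using sum_split_sign[of "\<lambda>l. f (nat \<bar>l\<bar>)" m] f0 by simp
      also have "\<dots> \<le> 2 * suminf f"
        using sum_le_suminf[OF f, of "{..m}"] f0 by auto
      finally show ?thesis .
    qed
    then show ?thesis by blast
  next
    assume B: "L \<subseteq> {1..} \<and> (\<forall>l\<in>L. a l = real (card (Z l)) \<and> card (Z l) = 2 ^ nat l)"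
    define f where "f n = ln 2 powr (-2 * d) * real n powr (-2 * d)" for n
    have f: "summable f"
      unfolding f_def using d by (intro summable_mult) (subst summable_real_powr_iff, simp)
    have f0: "f n \<ge> 0" for n by (auto simp: f_def)
    have "(\<Sum>l\<in>L \<inter> {- int m..int m}. wt a d l * real (card (Z l))) \<le> suminf f" for m
    proof -
      have "(\<Sum>l\<in>L \<inter> {- int m..int m}. wt a d l * real (card (Z l))) =
          (\<Sum>l\<in>L \<inter> {- int m..int m}. f (nat l))"
        using B by (intro sum.cong) (auto simp: wt_def f_def ln_realpow powr_mult mult.commute)
      also have "\<dots> = sum f (nat ` (L \<inter> {- int m..int m}))"
        using B by (subst sum.reindex) (auto simp: inj_on_def subset_iff)
      also have "\<dots> \<le> suminf f"
        by (intro sum_le_suminf f) (auto simp: f0)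
      finally show ?thesis .
    qed
    then show ?thesis by blast
  qed
qed

section \<open>Squared norms as suprema over windows of levels\<close>

context H_scale
begin

abbreviation I :: "(int \<times> int) set" where
  "I \<equiv> Sigma L Z"

text \<open>Symmetric windows exhaust \<open>L\<close> by an increasing sequence of finite sets.
  This turns an unordered infinite sum into a countable supremum, open to measurability arguments
  and monotone convergence.\<close>

definition window :: "nat \<Rightarrow> int set" where
  "window m = L \<inter> {- int m..int m}"

definition qsum :: "real \<Rightarrow> nat \<Rightarrow> (int \<times> int \<Rightarrow> real) \<Rightarrow> real" where
  "qsum d m c = (\<Sum>l\<in>window m. wt a d l * (\<Sum>k\<in>Z l. (c (l, k))\<^sup>2))"

text \<open>
  The squared norm with values in the extended reals. Unlike \<^const>\<open>norm_H\<close>, which is \<open>0\<close> on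
  families outside the space (the junk value of a divergent sum), it is \<open>\<infinity>\<close> there.
\<close>

definition Q :: "real \<Rightarrow> (int \<times> int \<Rightarrow> real) \<Rightarrow> ennreal" where
  "Q d c = (SUP m. ennreal (qsum d m c))"

lemma window [simp]: "finite (window m)" "window m \<subseteq> L"
  by (auto simp: window_def)

lemma windowD: "l \<in> window m \<Longrightarrow> l \<in> L"
  by (simp add: window_def)

lemma window_mono: "m \<le> m' \<Longrightarrow> window m \<subseteq> window m'"
  by (auto simp: window_def)

lemma finite_subset_window: "finite F \<Longrightarrow> F \<subseteq> L \<Longrightarrow> \<exists>m. F \<subseteq> window m"
proof (induction F rule: finite_induct)
  case (insert l F)
  then obtain m where "F \<subseteq> window m" by auto
  moreover have "window m \<subseteq> window (max m (nat \<bar>l\<bar>))" "l \<in> window (max m (nat \<bar>l\<bar>))"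
    using insert.prems by (simp_all add: window_mono) (auto simp: window_def)
  ultimately have "insert l F \<subseteq> window (max m (nat \<bar>l\<bar>))" by blast
  then show ?case by blast
qed simp

lemma finite_window_I [simp]: "finite (Sigma (window m) Z)"
  by (intro finite_SigmaI) (auto intro: finite_Z simp: window_def)

lemma wt_pos: "l \<in> L \<Longrightarrow> wt a d l > 0"
  using a_ge_2[of l] by (auto simp: wt_def)

lemma wt_nonneg: "l \<in> L \<Longrightarrow> wt a d l \<ge> 0"
  using wt_pos[of l d] by simp

lemma qsum_nonneg: "qsum d m c \<ge> 0"
  unfolding qsum_def by (intro sum_nonneg mult_nonneg_nonneg wt_nonneg) (auto simp: window_def)

lemma qsum_mono: "m \<le> m' \<Longrightarrow> qsum d m c \<le> qsum d m' c"
  unfolding qsum_def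
  by (intro sum_mono2 window_mono mult_nonneg_nonneg wt_nonneg sum_nonneg) (auto simp: window_def)

lemma qsum_alt: "qsum d m c = (\<Sum>i\<in>Sigma (window m) Z. wt a d (fst i) * (c i)\<^sup>2)"
proof -
  have "qsum d m c = (\<Sum>l\<in>window m. \<Sum>k\<in>Z l. wt a d l * (c (l, k))\<^sup>2)"
    by (simp add: qsum_def sum_distrib_left)
  also have "\<dots> = (\<Sum>(l, k)\<in>Sigma (window m) Z. wt a d l * (c (l, k))\<^sup>2)"
    by (rule sum.Sigma) (auto intro: finite_Z simp: window_def)
  finally show ?thesis by (simp add: case_prod_unfold)
qed

lemma qsum_cong: "(\<And>i. i \<in> I \<Longrightarrow> x i = y i) \<Longrightarrow> qsum d m x = qsum d m y"
  unfolding qsum_alt by (intro sum.cong) (auto simp: window_def)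

lemma Q_cong: "(\<And>i. i \<in> I \<Longrightarrow> x i = y i) \<Longrightarrow> Q d x = Q d y"
  unfolding Q_def by (simp cong: qsum_cong)

lemma Q_le: "(\<And>m. qsum d m c \<le> B) \<Longrightarrow> Q d c \<le> ennreal B"
  unfolding Q_def by (intro SUP_least ennreal_leI)

lemma qsum_le_Q: "ennreal (qsum d m c) \<le> Q d c"
  unfolding Q_def by (rule SUP_upper) simp

text \<open>The terms are nonnegative and every finite set of levels lies in some window, so the
  supremum over windows equals the supremum over all finite sets, which is the unordered
  sum.\<close>

lemma summable_norm_H: "Q d c < \<top> \<longleftrightarrow>
    (\<lambda>l. inverse (a l) * ln (a l) powr (-2 * d) * (\<Sum>k\<in>Z l. \<bar>c (l, k)\<bar>\<^sup>2)) summable_on L"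
  and norm_H_Q: "Q d c < \<top> \<Longrightarrow> ennreal ((norm_H L Z a d c)\<^sup>2) = Q d c"
proof -
  define g where
    "g l = inverse (a l) * ln (a l) powr (-2 * d) * (\<Sum>k\<in>Z l. \<bar>c (l, k)\<bar>\<^sup>2)" for l
  have g: "g l \<ge> 0" if "l \<in> L" for l
    using wt_nonneg[OF that, of d] by (auto simp: g_def wt_def intro!: mult_nonneg_nonneg sum_nonneg)
  have qs: "qsum d m c = sum g (window m)" for m
    by (simp add: qsum_def g_def wt_def)
  have fin: "g summable_on L" if "Q d c < \<top>"
  proof (rule nonneg_bdd_above_summable_on)
    from that obtain B where B: "B \<ge> 0" "Q d c = ennreal B"
      by (cases "Q d c") auto
    have "sum g F \<le> B" if F: "finite F" "F \<subseteq> L" for F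
    proof -
      obtain m where "F \<subseteq> window m" using finite_subset_window[OF F] by blast
      then have "sum g F \<le> qsum d m c"
        unfolding qs by (intro sum_mono2) (auto simp: window_def intro: g)
      also have "\<dots> \<le> B" using qsum_le_Q[of d m c] B by (simp add: ennreal_le_iff)
      finally show ?thesis .
    qed
    then show "bdd_above (sum g ` {F. F \<subseteq> L \<and> finite F})"
      by (auto intro!: bdd_aboveI)
  qed (rule g)
  have le: "Q d c \<le> ennreal (infsum g L)" if "g summable_on L"
    by (intro Q_le, unfold qs) (intro finite_sum_le_infsum that, auto simp: window_def intro: g)
  show *: "Q d c < \<top> \<longleftrightarrow>
    (\<lambda>l. inverse (a l) * ln (a l) powr (-2 * d) * (\<Sum>k\<in>Z l. \<bar>c (l, k)\<bar>\<^sup>2)) summable_on L"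
    using fin le ennreal_less_top order.strict_trans1 unfolding g_def by blast
  assume Q: "Q d c < \<top>"
  from Q obtain B where B: "B \<ge> 0" "Q d c = ennreal B"
    by (cases "Q d c") auto
  have "infsum g L \<le> B"
  proof (rule infsum_le_finite_sums)
    fix F assume F: "finite F" "F \<subseteq> L"
    obtain m where "F \<subseteq> window m" using finite_subset_window[OF F] by blast
    then have "sum g F \<le> qsum d m c"
      unfolding qs by (intro sum_mono2) (auto simp: window_def intro: g)
    also have "\<dots> \<le> B" using qsum_le_Q[of d m c] B by (simp add: ennreal_le_iff)
    finally show "sum g F \<le> B" .
  qed (rule fin[OF Q])
  then have "ennreal (infsum g L) \<le> Q d c" using B by (simp add: ennreal_leI)
  with le[OF fin[OF Q]] have "Q d c = ennreal (infsum g L)" by simp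
  moreover have "(norm_H L Z a d c)\<^sup>2 = infsum g L"
    unfolding norm_H_def g_def[symmetric] using infsum_nonneg[OF g] by simp
  ultimately show "ennreal ((norm_H L Z a d c)\<^sup>2) = Q d c" by simp
qed

lemma space_H_iff: "c \<in> space_H L Z a d \<longleftrightarrow> c \<in> extensional I \<and> Q d c < \<top>"
  by (auto simp: space_H_def summable_norm_H)

lemma norm_H_nonneg: "norm_H L Z a d c \<ge> 0"
  unfolding norm_H_def wt_def[symmetric]
  by (auto intro!: infsum_nonneg mult_nonneg_nonneg sum_nonneg wt_nonneg)

lemma norm_H_le_iff: "Q d c < \<top> \<Longrightarrow> 0 \<le> r \<Longrightarrow> norm_H L Z a d c \<le> r \<longleftrightarrow> Q d c \<le> ennreal (r\<^sup>2)"
  using norm_H_Q[of d c] norm_H_nonneg[of d c]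
  by (metis abs_le_square_iff abs_of_nonneg ennreal_le_iff zero_le_power2)

lemma norm_H_less_iff: "Q d c < \<top> \<Longrightarrow> 0 \<le> r \<Longrightarrow> norm_H L Z a d c < r \<longleftrightarrow> Q d c < ennreal (r\<^sup>2)"
  using norm_H_Q[of d c] norm_H_nonneg[of d c]
  by (metis abs_of_nonneg abs_square_less_1 ennreal_less_iff linorder_not_le power2_le_imp_le
      power_mono zero_le_power2)

text \<open>The factors come from
  \<open>(s + t)\<^sup>2 \<le> 2 * s\<^sup>2 + 2 * t\<^sup>2\<close>. Estimating squares in this
  way, instead of norms by the triangle inequality, gives a sum rule in \<open>ennreal\<close> that
  also covers families outside the space.\<close>

lemma qsum_add: "qsum d m (\<lambda>i. x i + y i) \<le> 2 * qsum d m x + 2 * qsum d m y"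
proof -
  have "wt a d l * (s + t)\<^sup>2 \<le> 2 * (wt a d l * s\<^sup>2) + 2 * (wt a d l * t\<^sup>2)" if "l \<in> L" for l and s t :: real
  proof -
    have "(s + t)\<^sup>2 \<le> 2 * s\<^sup>2 + 2 * t\<^sup>2"
      using sum_squares_bound[of s t] by (simp add: power2_sum)
    from mult_left_mono[OF this wt_nonneg[OF that, of d]] show ?thesis
      by (simp add: algebra_simps)
  qed
  then show ?thesis
    unfolding qsum_alt sum_distrib_left sum.distrib[symmetric]
    by (intro sum_mono) (auto simp: window_def)
qed

lemma Q_add: "Q d (\<lambda>i. x i + y i) \<le> 2 * Q d x + 2 * Q d y"
  unfolding Q_def[of d "\<lambda>i. x i + y i"]
proof (rule SUP_least)
  fix m
  have "ennreal (qsum d m (\<lambda>i. x i + y i)) \<le> ennreal (2 * qsum d m x + 2 * qsum d m y)"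
    by (intro ennreal_leI qsum_add)
  also have "\<dots> = 2 * ennreal (qsum d m x) + 2 * ennreal (qsum d m y)"
    by (simp add: ennreal_plus ennreal_mult qsum_nonneg)
  also have "\<dots> \<le> 2 * Q d x + 2 * Q d y"
    by (intro add_mono mult_left_mono qsum_le_Q) auto
  finally show "ennreal (qsum d m (\<lambda>i. x i + y i)) \<le> 2 * Q d x + 2 * Q d y" .
qed

lemma qsum_scale: "qsum d m (\<lambda>i. r * x i) = r\<^sup>2 * qsum d m x"
  by (simp add: qsum_alt sum_distrib_left power_mult_distrib mult.left_commute)

lemma Q_scale: "Q d (\<lambda>i. r * x i) = ennreal (r\<^sup>2) * Q d x"
  by (simp add: Q_def qsum_scale ennreal_mult qsum_nonneg SUP_mult_left_ennreal)

lemma Q_minus: "Q d (\<lambda>i. - x i) = Q d x"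
  using Q_scale[of d "-1" x] by simp

lemma Q_diff: "Q d (\<lambda>i. x i - y i) \<le> 2 * Q d x + 2 * Q d y"
  using Q_add[of d x "\<lambda>i. - y i"] by (simp add: Q_minus)

lemma Q_add_finite: "Q d x < \<top> \<Longrightarrow> Q d y < \<top> \<Longrightarrow> Q d (\<lambda>i. x i + y i) < \<top>"
  by (rule order.strict_trans1[OF Q_add]) (simp add: ennreal_mult_less_top)

lemma Q_diff_finite: "Q d x < \<top> \<Longrightarrow> Q d y < \<top> \<Longrightarrow> Q d (\<lambda>i. x i - y i) < \<top>"
  by (rule order.strict_trans1[OF Q_diff]) (simp add: ennreal_mult_less_top)

lemma Q_scale_finite: "Q d x < \<top> \<Longrightarrow> Q d (\<lambda>i. r * x i) < \<top>"
  by (simp add: Q_scale ennreal_mult_less_top)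

lemma coeff_le_Q:
  assumes "i \<in> I"
  shows "ennreal (wt a d (fst i) * (c i)\<^sup>2) \<le> Q d c"
proof -
  obtain m where "{fst i} \<subseteq> window m"
    using assms finite_subset_window[of "{fst i}"] by auto
  then have "wt a d (fst i) * (c i)\<^sup>2 \<le> qsum d m c"
    unfolding qsum_alt using assms
    by (intro member_le_sum) (auto intro!: mult_nonneg_nonneg wt_nonneg dest: windowD)
  then show ?thesis
    by (meson ennreal_leI order_trans qsum_le_Q)
qed

lemma Metric: "Metric_space (space_H L Z a d) (dist_H L Z a d)"
  by (rule Metric_space_H) (use a_ge_2 finite_Z in force)+

lemma measurable_Q:
  assumes "\<And>i. i \<in> I \<Longrightarrow> (\<lambda>x. g x i) \<in> borel_measurable M"
  shows "(\<lambda>x. Q d (g x)) \<in> borel_measurable M"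
proof -
  have "(\<lambda>x. qsum d m (g x)) \<in> borel_measurable M" for m
    unfolding qsum_alt using assms
    by (intro borel_measurable_sum borel_measurable_times borel_measurable_power) (auto simp: window_def)
  then show ?thesis
    unfolding Q_def by simp
qed

end

section \<open>Borel sets and coefficients\<close>

text \<open>The residual \<open>f - p\<close>, with \<open>p\<close> the orthogonal projection, has
  nonnegative squared norm, and \<open>inner p p = inner f p\<close>.\<close>

lemma bessel_inequality:
  fixes e :: "'i \<Rightarrow> 'a::real_inner"
  assumes "finite F" "\<And>i j. i \<in> F \<Longrightarrow> j \<in> F \<Longrightarrow> inner (e i) (e j) = (if i = j then 1 else 0)"
  shows "(\<Sum>i\<in>F. (inner f (e i))\<^sup>2) \<le> (norm f)\<^sup>2"
proof -
  define p where "p = (\<Sum>i\<in>F. inner f (e i) *\<^sub>R e i)"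
  have fp: "inner f p = (\<Sum>i\<in>F. (inner f (e i))\<^sup>2)"
    by (simp add: p_def inner_sum_right power2_eq_square)
  have "inner p p = (\<Sum>i\<in>F. \<Sum>j\<in>F. inner f (e i) * (inner f (e j) * inner (e j) (e i)))"
    by (simp add: p_def inner_sum_right inner_sum_left sum_distrib_left mult.left_commute)
  also have "\<dots> = (\<Sum>i\<in>F. \<Sum>j\<in>F. if i = j then (inner f (e i))\<^sup>2 else 0)"
    using assms(2) by (intro sum.cong refl) (auto simp: power2_eq_square)
  finally have pp: "inner p p = inner f p"
    using assms(1) by (simp add: fp)
  have "0 \<le> inner (f - p) (f - p)" by simp
  then show ?thesis
    unfolding fp[symmetric] by (simp add: inner_diff inner_commute pp power2_norm_eq_inner)
qed

context H_scale
begin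

text \<open>The value off the window is 0 even off the index set, so the result need not be
  \<open>extensional\<close> and may lie outside the space; \<open>Q\<close> does not see the
  difference. \<open>truncate\<close> is the variant inside the space.\<close>

definition trunc :: "nat \<Rightarrow> (int \<times> int \<Rightarrow> real) \<Rightarrow> int \<times> int \<Rightarrow> real" where
  "trunc m c = (\<lambda>i. if i \<in> Sigma (window m) Z then c i else 0)"

lemma Q_finite_support:
  assumes "\<And>i. i \<in> I \<Longrightarrow> i \<notin> Sigma (window m) Z \<Longrightarrow> x i = 0"
  shows "Q d x = ennreal (qsum d m x)"
proof (rule antisym)
  show "Q d x \<le> ennreal (qsum d m x)"
  proof (rule Q_le)
    fix m'
    have "qsum d m' x = (\<Sum>i\<in>Sigma (window m') Z \<inter> Sigma (window m) Z. wt a d (fst i) * (x i)\<^sup>2)"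
      unfolding qsum_alt using assms
      by (intro sum.mono_neutral_right) (auto dest: windowD)
    also have "\<dots> \<le> qsum d m x"
      unfolding qsum_alt
      by (intro sum_mono2) (auto intro!: mult_nonneg_nonneg wt_nonneg dest: windowD)
    finally show "qsum d m' x \<le> qsum d m x" .
  qed
qed (rule qsum_le_Q)

lemma trunc_finite: "Q d (trunc m c) < \<top>"
  by (subst Q_finite_support[of m]) (auto simp: trunc_def)

text \<open>Head and tail have disjoint supports, so their squared norms add up as in Pythagoras'
  theorem, on any window that contains \<open>window m\<close>.\<close>

lemma Q_tail:
  assumes "Q d c = ennreal B" "0 \<le> B"
  shows "Q d (\<lambda>i. c i - trunc m c i) \<le> ennreal (B - qsum d m c)"
proof (rule Q_le)
  fix m'
  let ?t = "\<lambda>i. c i - trunc m c i" and ?M = "max m m'"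
  have "qsum d m' ?t \<le> qsum d ?M ?t" by (rule qsum_mono) simp
  also have "qsum d ?M ?t + qsum d m c = qsum d ?M c"
  proof -
    have sub: "Sigma (window m) Z \<subseteq> Sigma (window ?M) Z"
      using window_mono[of m ?M] by auto
    have "qsum d ?M ?t = (\<Sum>i\<in>Sigma (window ?M) Z - Sigma (window m) Z. wt a d (fst i) * (c i)\<^sup>2)"
      unfolding qsum_alt by (intro sum.mono_neutral_cong_right) (auto simp: trunc_def)
    then show ?thesis
      using sum.subset_diff[OF sub, of "\<lambda>i. wt a d (fst i) * (c i)\<^sup>2"] by (simp add: qsum_alt)
  qed
  then have "qsum d ?M ?t = qsum d ?M c - qsum d m c" by linarith
  also have "qsum d ?M c \<le> B"
    using qsum_le_Q[of d ?M c] assms by simp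
  finally show "qsum d m' ?t \<le> B - qsum d m c" by simp
qed

text \<open>A countable dense set. Extensional functions on a finite index set keep it countable;
  \<open>trunc\<close> then replaces \<open>undefined\<close> by 0.\<close>

definition rational_families :: "(int \<times> int \<Rightarrow> real) set" where
  "rational_families = (\<Union>m. trunc m ` (Sigma (window m) Z \<rightarrow>\<^sub>E \<rat>))"

lemma countable_rational_families: "countable rational_families"
  unfolding rational_families_def
  by (intro countable_UN countable_image countable_PiE) (auto intro: countable_rat)

lemma rational_families_dense:
  assumes "Q d c < \<top>" "0 < r"
  shows "\<exists>q\<in>rational_families. Q d (\<lambda>i. c i - q i) < ennreal r"
proof -
  obtain B where B: "Q d c = ennreal B" "B \<ge> 0"
    using assms(1) by (cases "Q d c") auto
  \<comment> \<open>Tail and rational approximation each get \<open>r / 4\<close>;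
    \<open>Q_add\<close> doubles both, and the strict inequality for the tail makes the total less
    than \<open>r\<close>.\<close>
  have "\<exists>m. B - r / 4 < qsum d m c"
  proof (rule ccontr)
    assume "\<not> ?thesis"
    then have le: "qsum d m c \<le> B - r / 4" for m by (simp add: not_less)
    then have "Q d c \<le> ennreal (B - r / 4)" by (rule Q_le)
    \<comment> \<open>Negative reals become 0 under \<open>ennreal\<close>, so the sign must be
      known before the two sides can be compared as reals.\<close>
    moreover have "0 \<le> B - r / 4" using le[of 0] qsum_nonneg[of d 0 c] by linarith
    ultimately show False using B assms(2) by (simp add: ennreal_le_iff)
  qed
  then obtain m where m: "B - r / 4 < qsum d m c" by blast
  let ?J = "Sigma (window m) Z"
  define W where "W = (\<Sum>i\<in>?J. wt a d (fst i))"
  have W: "W \<ge> 0" unfolding W_def by (intro sum_nonneg wt_nonneg) (auto dest: windowD)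
  \<comment> \<open>Chosen so that the weights times \<open>\<eta>\<^sup>2\<close> sum to at most
    \<open>r / 4\<close>; the summand 1 avoids division by zero when the window carries no
    indices.\<close>
  define \<eta> where "\<eta> = sqrt (r / 4 / (W + 1))"
  have \<eta>: "\<eta> > 0" "\<eta>\<^sup>2 = r / 4 / (W + 1)" using assms(2) W by (auto simp: \<eta>_def)
  have "\<forall>i. \<exists>p. p \<in> \<rat> \<and> \<bar>c i - p\<bar> \<le> \<eta>"
  proof
    fix i
    obtain p where "p \<in> \<rat>" "c i - \<eta> < p" "p < c i + \<eta>"
      using Rats_dense_in_real[of "c i - \<eta>" "c i + \<eta>"] \<eta> by auto
    then show "\<exists>p. p \<in> \<rat> \<and> \<bar>c i - p\<bar> \<le> \<eta>" by (intro exI[of _ p]) (auto simp: abs_le_iff)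
  qed
  then obtain p where p: "\<And>i. p i \<in> \<rat>" "\<And>i. \<bar>c i - p i\<bar> \<le> \<eta>" by metis
  define q where "q = trunc m p"
  have "q = trunc m (restrict p ?J)" by (auto simp: q_def trunc_def)
  then have q: "q \<in> rational_families"
    unfolding rational_families_def using p(1) by (intro UN_I[of m]) auto
  have "Q d (\<lambda>i. trunc m c i - q i) = ennreal (qsum d m (\<lambda>i. trunc m c i - q i))"
    by (intro Q_finite_support) (auto simp: q_def trunc_def)
  also have "qsum d m (\<lambda>i. trunc m c i - q i) \<le> (\<Sum>i\<in>?J. wt a d (fst i) * \<eta>\<^sup>2)"
    unfolding qsum_alt
  proof (intro sum_mono mult_left_mono)
    fix i assume i: "i \<in> ?J"
    then have "(trunc m c i - q i)\<^sup>2 = \<bar>c i - p i\<bar>\<^sup>2" by (simp add: q_def trunc_def)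
    also have "\<dots> \<le> \<eta>\<^sup>2" by (rule power_mono) (use p(2) in auto)
    finally show "(trunc m c i - q i)\<^sup>2 \<le> \<eta>\<^sup>2" .
    show "0 \<le> wt a d (fst i)" using i windowD[of "fst i" m] by (intro wt_nonneg) auto
  qed
  also have "\<dots> = r / 4 * (W / (W + 1))"
    unfolding sum_distrib_right[symmetric] W_def[symmetric] \<eta>(2) by simp
  also have "\<dots> \<le> r / 4"
    using W assms(2) by (intro mult_right_le_one_le) auto
  finally have *: "Q d (\<lambda>i. trunc m c i - q i) \<le> ennreal (r / 4)" by (simp add: ennreal_leI)
  have "Q d (\<lambda>i. c i - q i) = Q d (\<lambda>i. (c i - trunc m c i) + (trunc m c i - q i))" by simp
  also have "\<dots> \<le> 2 * Q d (\<lambda>i. c i - trunc m c i) + 2 * Q d (\<lambda>i. trunc m c i - q i)"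
    by (rule Q_add)
  also have "\<dots> \<le> 2 * ennreal (B - qsum d m c) + 2 * ennreal (r / 4)"
    by (intro add_mono mult_left_mono Q_tail[OF B] *) auto
  also have "\<dots> = ennreal (2 * (B - qsum d m c) + 2 * (r / 4))"
  proof -
    have "qsum d m c \<le> B" using qsum_le_Q[of d m c] B by simp
    then show ?thesis using assms(2)
      by (simp add: ennreal_mult[of 2, simplified, symmetric] ennreal_plus[symmetric] del: ennreal_plus)
  qed
  also have "\<dots> < ennreal r" using m assms(2) by (intro ennreal_lessI) auto
  finally show ?thesis using q by blast
qed

lemma space_borel_H [simp]: "space (borel_H L Z a d) = space_H L Z a d"
  unfolding borel_H_def by (rule space_measure_of) (auto simp: Metric_space.openin_mtopology[OF Metric])

lemma sets_borel_H_open: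
  "openin (Metric_space.mtopology (space_H L Z a d) (dist_H L Z a d)) U \<Longrightarrow> U \<in> sets (borel_H L Z a d)"
  unfolding borel_H_def
  by (subst sets_measure_of) (auto simp: Metric_space.openin_mtopology[OF Metric])

lemma dist_H_less_iff:
  assumes "Q d x < \<top>" "Q d y < \<top>" "0 \<le> r"
  shows "dist_H L Z a d x y < r \<longleftrightarrow> Q d (\<lambda>i. x i - y i) < ennreal (r\<^sup>2)"
  unfolding dist_H_def using assms by (intro norm_H_less_iff Q_diff_finite) auto

text \<open>
  Separability makes the Borel sets of the space coincide with those generated by the coefficients.
\<close>

lemma measurable_borel_H:
  assumes sp: "\<And>x. x \<in> space M \<Longrightarrow> g x \<in> space_H L Z a d"
    and co: "\<And>i. i \<in> I \<Longrightarrow> (\<lambda>x. g x i) \<in> borel_measurable M"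
  shows "g \<in> M \<rightarrow>\<^sub>M borel_H L Z a d"
  unfolding borel_H_def
proof (rule measurable_measure_of)
  show "g \<in> space M \<rightarrow> space_H L Z a d" using sp by auto
  show "{U. openin (Metric_space.mtopology (space_H L Z a d) (dist_H L Z a d)) U}
      \<subseteq> Pow (space_H L Z a d)"
    by (auto simp: Metric_space.openin_mtopology[OF Metric])
  fix U assume "U \<in> {U. openin (Metric_space.mtopology (space_H L Z a d) (dist_H L Z a d)) U}"
  then have U: "U \<subseteq> space_H L Z a d"
      "\<And>c. c \<in> U \<Longrightarrow> \<exists>r>0. Metric_space.mball (space_H L Z a d) (dist_H L Z a d) c r \<subseteq> U"
    by (auto simp: Metric_space.openin_mtopology[OF Metric])
  \<comment> \<open>These balls are stated through \<open>Q\<close> because their centres, being 0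
    off the index set, need not belong to the metric space.\<close>
  define N where "N q k = {c \<in> space_H L Z a d. Q d (\<lambda>i. c i - q i) < ennreal (1 / real (Suc k))}" for q k
  define T where "T = {(q, k). q \<in> rational_families \<and> N q k \<subseteq> U}"
  have "countable (rational_families \<times> (UNIV :: nat set))"
    by (intro countable_SIGMA countable_rational_families) auto
  then have cT: "countable T"
    by (rule countable_subset[rotated]) (auto simp: T_def)
  have cover: "\<exists>(q, k)\<in>T. c \<in> N q k" if c: "c \<in> U" for c
  proof -
    from U(2)[OF c] obtain r where r: "r > 0"
      and ball: "Metric_space.mball (space_H L Z a d) (dist_H L Z a d) c r \<subseteq> U" by blast
    have cH: "c \<in> space_H L Z a d" "Q d c < \<top>" using c U(1) space_H_iff by auto
    \<comment> \<open>Two points of \<open>N q k\<close> are at squared distance less than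
      \<open>r\<^sup>2\<close> once \<open>4 / real (Suc k) < r\<^sup>2\<close>, the 4 being the two
      doublings of \<open>Q_diff\<close>.\<close>
    obtain k where k: "1 / real (Suc k) < r\<^sup>2 / 4"
      using r nat_approx_posE[of "r\<^sup>2 / 4"] by (metis divide_pos_pos zero_less_numeral zero_less_power)
    obtain q where q: "q \<in> rational_families" "Q d (\<lambda>i. c i - q i) < ennreal (1 / real (Suc k))"
      using rational_families_dense[OF cH(2), of "1 / real (Suc k)"] by auto
    have "N q k \<subseteq> U"
    proof
      fix c' assume c': "c' \<in> N q k"
      then have c'H: "c' \<in> space_H L Z a d" "Q d c' < \<top>" by (auto simp: N_def space_H_iff)
      have "Q d (\<lambda>i. c i - c' i) = Q d (\<lambda>i. (c i - q i) - (c' i - q i))" by simp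
      also have "\<dots> \<le> 2 * Q d (\<lambda>i. c i - q i) + 2 * Q d (\<lambda>i. c' i - q i)" by (rule Q_diff)
      also have "\<dots> \<le> 2 * ennreal (1 / real (Suc k)) + 2 * ennreal (1 / real (Suc k))"
        using q(2) c' by (intro add_mono mult_left_mono) (auto simp: N_def less_imp_le)
      also have "\<dots> = ennreal (4 * (1 / real (Suc k)))"
        by (subst (1 2) ennreal_numeral[symmetric])
          (simp only: ennreal_mult[symmetric] ennreal_plus[symmetric] zero_le_numeral zero_le_divide_iff
            of_nat_0_le_iff zero_le_one mult_nonneg_nonneg simp_thms, simp)
      also have "\<dots> < ennreal (r\<^sup>2)" using k r by (intro ennreal_lessI) auto
      finally have "dist_H L Z a d c c' < r"
        using r cH c'H by (subst dist_H_less_iff) auto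
      with cH c'H ball show "c' \<in> U"
        by (auto simp: Metric_space.mball_def[OF Metric] subset_iff)
    qed
    with q cH show ?thesis by (intro bexI[of _ "(q, k)"]) (auto simp: T_def N_def)
  qed
  have "g -` U \<inter> space M = (\<Union>(q, k)\<in>T. {x \<in> space M. Q d (\<lambda>i. g x i - q i) < ennreal (1 / real (Suc k))})"
  proof (intro equalityI subsetI)
    fix x assume "x \<in> g -` U \<inter> space M"
    then show "x \<in> (\<Union>(q, k)\<in>T. {x \<in> space M. Q d (\<lambda>i. g x i - q i) < ennreal (1 / real (Suc k))})"
      using cover[of "g x"] by (fastforce simp: N_def)
  next
    fix x assume "x \<in> (\<Union>(q, k)\<in>T. {x \<in> space M. Q d (\<lambda>i. g x i - q i) < ennreal (1 / real (Suc k))})"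
    then obtain q k where qk: "(q, k) \<in> T" "x \<in> space M" "Q d (\<lambda>i. g x i - q i) < ennreal (1 / real (Suc k))"
      by auto
    with sp[of x] have "g x \<in> N q k" by (simp add: N_def)
    with qk show "x \<in> g -` U \<inter> space M" by (auto simp: T_def)
  qed
  also have "\<dots> \<in> sets M"
  proof (intro sets.countable_UN'[OF cT], clarify)
    fix q k
    have [measurable]: "(\<lambda>x. Q d (\<lambda>i. g x i - q i)) \<in> borel_measurable M"
      by (intro measurable_Q borel_measurable_diff co) auto
    show "{x \<in> space M. Q d (\<lambda>i. g x i - q i) < ennreal (1 / real (Suc k))} \<in> sets M"
      by measurable
  qed
  finally show "g -` U \<inter> space M \<in> sets M" .
qed

lemma Lipschitz_measurable_borel_H:
  fixes u :: "(int \<times> int \<Rightarrow> real) \<Rightarrow> 'b::metric_space"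
  assumes "\<And>x y. x \<in> space_H L Z a d \<Longrightarrow> y \<in> space_H L Z a d \<Longrightarrow> dist (u x) (u y) \<le> C * dist_H L Z a d x y"
  shows "u \<in> borel_H L Z a d \<rightarrow>\<^sub>M borel"
proof (rule borel_measurableI)
  fix U :: "'b set" assume U: "open U"
  interpret Metric_space "space_H L Z a d" "dist_H L Z a d" by (rule Metric)
  have "openin mtopology (u -` U \<inter> space_H L Z a d)"
    unfolding openin_mtopology
  proof (intro conjI allI impI)
    fix x assume x: "x \<in> u -` U \<inter> space_H L Z a d"
    then obtain e where e: "e > 0" "\<And>y. dist y (u x) < e \<Longrightarrow> y \<in> U"
      using U unfolding open_dist by blast
    \<comment> \<open>\<open>C\<close> may be zero or negative; \<open>\<bar>C\<bar> + 1\<close> is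
      positive and still a Lipschitz constant.\<close>
    define r where "r = e / (\<bar>C\<bar> + 1)"
    have r: "r > 0" using e by (simp add: r_def add_nonneg_pos)
    have "mball x r \<subseteq> u -` U \<inter> space_H L Z a d"
    proof
      fix y assume "y \<in> mball x r"
      then have y: "y \<in> space_H L Z a d" "dist_H L Z a d x y < r" by auto
      have "dist (u x) (u y) \<le> C * dist_H L Z a d x y" using x y assms by auto
      also have "\<dots> \<le> (\<bar>C\<bar> + 1) * dist_H L Z a d x y" by (intro mult_right_mono) auto
      also have "\<dots> < (\<bar>C\<bar> + 1) * r" using y by (intro mult_strict_left_mono) auto
      also have "\<dots> = e" by (simp add: r_def add_nonneg_eq_0_iff)
      finally have "u y \<in> U" using e(2) by (simp add: dist_commute)
      with y show "y \<in> u -` U \<inter> space_H L Z a d" by simp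
    qed
    with r show "\<exists>r>0. mball x r \<subseteq> u -` U \<inter> space_H L Z a d" by blast
  qed auto
  then show "u -` U \<inter> space (borel_H L Z a d) \<in> sets (borel_H L Z a d)"
    by (simp add: sets_borel_H_open)
qed

text \<open>One weighted square is at most the whole squared norm. Evaluations are thus Lipschitz
  and hence Borel, which complements \<open>measurable_borel_H\<close>.\<close>

lemma coeff_le_dist_H:
  assumes "i \<in> I" "x \<in> space_H L Z a d" "y \<in> space_H L Z a d"
  shows "\<bar>x i - y i\<bar> \<le> inverse (sqrt (wt a d (fst i))) * dist_H L Z a d x y"
proof -
  have w: "wt a d (fst i) > 0" using assms wt_pos by auto
  have "Q d (\<lambda>i. x i - y i) < \<top>" using assms by (intro Q_diff_finite) (auto simp: space_H_iff)
  then have "ennreal (wt a d (fst i) * (x i - y i)\<^sup>2) \<le> ennreal ((dist_H L Z a d x y)\<^sup>2)"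
    using coeff_le_Q[OF assms(1), of d "\<lambda>i. x i - y i"] norm_H_Q[of d "\<lambda>i. x i - y i"] by (simp add: dist_H_def)
  then have "wt a d (fst i) * (x i - y i)\<^sup>2 \<le> (dist_H L Z a d x y)\<^sup>2"
    by (simp add: ennreal_le_iff)
  then have "sqrt (wt a d (fst i) * (x i - y i)\<^sup>2) \<le> sqrt ((dist_H L Z a d x y)\<^sup>2)"
    by (rule real_sqrt_le_mono)
  then have "sqrt (wt a d (fst i)) * \<bar>x i - y i\<bar> \<le> dist_H L Z a d x y"
    using norm_H_nonneg by (simp add: real_sqrt_mult dist_H_def)
  then show ?thesis using w by (simp add: field_simps)
qed

lemma measurable_coeff [measurable (raw)]:
  assumes "i \<in> I"
  shows "(\<lambda>x. x i) \<in> borel_measurable (borel_H L Z a d)"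
  by (rule Lipschitz_measurable_borel_H) (use coeff_le_dist_H[OF assms] in \<open>simp add: dist_real_def\<close>)

lemma measurable_Q_borel_H: "Q d' \<in> borel_measurable (borel_H L Z a d)"
  by (rule measurable_Q) (rule measurable_coeff)

end

section \<open>White noise\<close>

lemma nn_integral_std_normal_square:
  "(\<integral>\<^sup>+x. ennreal (x\<^sup>2) \<partial>std_normal_distribution) = 1"
proof -
  have "(\<integral>\<^sup>+x. ennreal (x\<^sup>2) \<partial>std_normal_distribution) =
      (\<integral>\<^sup>+x. ennreal (std_normal_density x * x ^ (2 * 1)) \<partial>lborel)"
    by (subst nn_integral_density) (auto simp: ennreal_mult[symmetric])
  also have "\<dots> = ennreal (fact (2 * 1) / (2 ^ 1 * fact 1))"
    using std_normal_moment_even[of 1]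
    by (intro nn_integral_eq_integral[THEN trans])
      (auto simp: has_bochner_integral_iff normal_density_nonneg)
  also have "\<dots> = 1" by simp
  finally show ?thesis .
qed

lemma prob_space_std_normal: "prob_space std_normal_distribution"
  by (rule prob_space_normal_density) simp

context H_scale
begin

text \<open>Moments and marginals are computed for the product law on all families and then
  transferred to its trace on the space, a measurable set of full measure when
  \<open>d > 1/2\<close>.\<close>

definition W :: "(int \<times> int \<Rightarrow> real) measure" where
  "W = PiM I (\<lambda>_. std_normal_distribution)"

sublocale white: product_prob_space "\<lambda>_. std_normal_distribution" I
  by (intro product_prob_spaceI prob_space_std_normal)

lemma prob_space_W: "prob_space W"
  unfolding W_def by (rule prob_space_PiM) (rule prob_space_std_normal)

lemma space_W: "space W = extensional I"
  by (auto simp: W_def space_PiM PiE_def)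

lemma measurable_W_coeff [measurable (raw)]: "i \<in> I \<Longrightarrow> (\<lambda>w. w i) \<in> borel_measurable W"
  unfolding W_def using measurable_component_singleton[of i I "\<lambda>_. std_normal_distribution"] by simp

lemma nn_integral_W_square:
  assumes "i \<in> I"
  shows "(\<integral>\<^sup>+w. ennreal ((w i)\<^sup>2) \<partial>W) = 1"
proof -
  have "(\<integral>\<^sup>+w. ennreal ((w i)\<^sup>2) \<partial>W) =
      (\<integral>\<^sup>+x. ennreal (x\<^sup>2) \<partial>distr W std_normal_distribution (\<lambda>w. w i))"
    using assms unfolding W_def by (intro nn_integral_distr[symmetric]) auto
  also have "distr W std_normal_distribution (\<lambda>w. w i) = std_normal_distribution"
    unfolding W_def using assms by (intro distr_PiM_component prob_space_std_normal)
  finally show ?thesis by (simp add: nn_integral_std_normal_square)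
qed

text \<open>Each coefficient has second moment 1, so the expectation over a window is a partial
  trace; monotone convergence passes to the supremum.\<close>

lemma nn_integral_Q_W:
  assumes "d > 1/2"
  shows "\<exists>C\<ge>0. (\<integral>\<^sup>+w. Q d w \<partial>W) \<le> ennreal C"
proof -
  obtain C where C: "\<And>m. (\<Sum>l\<in>window m. wt a d l * real (card (Z l))) \<le> C"
    using trace_class[OF assms] unfolding window_def by blast
  have [measurable]: "(\<lambda>w. qsum d m w) \<in> borel_measurable W" for m
    unfolding qsum_alt
    by (intro borel_measurable_sum borel_measurable_times borel_measurable_power measurable_W_coeff)
      (auto dest: windowD)
  have q: "(\<integral>\<^sup>+w. ennreal (qsum d m w) \<partial>W) \<le> ennreal C" for m
  proof -
    have "(\<integral>\<^sup>+w. ennreal (qsum d m w) \<partial>W) =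
        (\<integral>\<^sup>+w. (\<Sum>i\<in>Sigma (window m) Z. ennreal (wt a d (fst i)) * ennreal ((w i)\<^sup>2)) \<partial>W)"
      unfolding qsum_alt using windowD wt_nonneg
      by (intro nn_integral_cong, subst sum_ennreal[symmetric])
        (auto intro!: sum.cong ennreal_mult mult_nonneg_nonneg)
    also have "\<dots> = (\<Sum>i\<in>Sigma (window m) Z. ennreal (wt a d (fst i)) * (\<integral>\<^sup>+w. ennreal ((w i)\<^sup>2) \<partial>W))"
    proof (subst nn_integral_sum)
      fix i assume "i \<in> Sigma (window m) Z"
      then have "i \<in> I" by (auto dest: windowD)
      then show "(\<lambda>w. ennreal (wt a d (fst i)) * ennreal ((w i)\<^sup>2)) \<in> borel_measurable W"
        by measurable
    next
      show "(\<Sum>i\<in>Sigma (window m) Z. \<integral>\<^sup>+ w. ennreal (wt a d (fst i)) * ennreal ((w i)\<^sup>2) \<partial>W) =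
          (\<Sum>i\<in>Sigma (window m) Z. ennreal (wt a d (fst i)) * (\<integral>\<^sup>+w. ennreal ((w i)\<^sup>2) \<partial>W))"
      proof (intro sum.cong refl nn_integral_cmult)
        fix i assume "i \<in> Sigma (window m) Z"
        then have "i \<in> I" by (auto dest: windowD)
        then show "(\<lambda>w. ennreal ((w i)\<^sup>2)) \<in> borel_measurable W"
          by measurable
      qed
    qed
    also have "\<dots> = (\<Sum>i\<in>Sigma (window m) Z. ennreal (wt a d (fst i)))"
      by (intro sum.cong refl) (auto simp: nn_integral_W_square dest: windowD)
    also have "\<dots> = ennreal (\<Sum>i\<in>Sigma (window m) Z. wt a d (fst i))"
      using windowD wt_nonneg by (intro sum_ennreal) auto
    also have "(\<Sum>i\<in>Sigma (window m) Z. wt a d (fst i)) = (\<Sum>l\<in>window m. \<Sum>k\<in>Z l. wt a d l)"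
      by (subst sum.Sigma) (auto intro: finite_Z dest: windowD simp: case_prod_unfold)
    also have "\<dots> = (\<Sum>l\<in>window m. wt a d l * real (card (Z l)))"
      by (simp add: mult.commute)
    finally show ?thesis using C[of m] by (simp add: ennreal_leI)
  qed
  have "(\<integral>\<^sup>+w. Q d w \<partial>W) = (SUP m. \<integral>\<^sup>+w. ennreal (qsum d m w) \<partial>W)"
    unfolding Q_def
    by (intro nn_integral_monotone_convergence_SUP)
      (auto simp: incseq_def le_fun_def intro!: ennreal_leI qsum_mono)
  also have "\<dots> \<le> ennreal C" by (intro SUP_least q)
  finally show ?thesis
    by (intro exI[of _ "max 0 C"]) (auto simp: max_def ennreal_neg)
qed

lemma measurable_Q_W: "Q d \<in> borel_measurable W"
  by (rule measurable_Q) (rule measurable_W_coeff)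

lemma AE_W_space_H:
  assumes "d > 1/2"
  shows "AE w in W. w \<in> space_H L Z a d"
proof -
  obtain C where "(\<integral>\<^sup>+w. Q d w \<partial>W) \<le> ennreal C" using nn_integral_Q_W[OF assms] by blast
  then have "(\<integral>\<^sup>+w. Q d w \<partial>W) \<noteq> \<infinity>"
    by (metis ennreal_neq_top infinity_ennreal_def neq_top_trans)
  then have "AE w in W. Q d w \<noteq> \<infinity>"
    by (intro nn_integral_noteq_infinite measurable_Q_W)
  then show ?thesis
    using AE_space by eventually_elim (auto simp: space_H_iff space_W less_top)
qed

lemma space_H_sets_W: "space_H L Z a d \<in> sets W"
proof -
  note measurable_Q_W[measurable]
  have "space_H L Z a d = {w \<in> space W. Q d w < \<top>}"
    by (auto simp: space_H_iff space_W)
  then show ?thesis by simp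
qed

lemma measurable_id_borel_H: "(\<lambda>w. w) \<in> restrict_space W (space_H L Z a d) \<rightarrow>\<^sub>M borel_H L Z a d"
  by (rule measurable_borel_H) (auto simp: space_restrict_space intro!: measurable_restrict_space1 measurable_W_coeff)

lemma white_noise_alt:
  "white_noise L Z a d = distr (restrict_space W (space_H L Z a d)) (borel_H L Z a d) (\<lambda>w. w)"
  by (simp add: white_noise_def W_def)

lemma prob_space_white_noise:
  assumes "d > 1/2"
  shows "prob_space (white_noise L Z a d)"
  unfolding white_noise_alt
proof (rule prob_space.prob_space_distr[OF _ measurable_id_borel_H])
  interpret W: prob_space W by (rule prob_space_W)
  show "prob_space (restrict_space W (space_H L Z a d))"
    using AE_W_space_H[OF assms] space_H_sets_W
    by (intro prob_space_restrict_space) (auto simp: W.emeasure_eq_1_AE)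
qed

lemma sets_white_noise [simp]: "sets (white_noise L Z a d) = sets (borel_H L Z a d)"
  and space_white_noise [simp]: "space (white_noise L Z a d) = space_H L Z a d"
  by (simp_all add: white_noise_def)

text \<open>The exponent \<open>d'\<close> of the norm and the exponent \<open>d\<close> of the
  space carrying the noise are decoupled: the stronger norm will be integrated over the larger
  space.\<close>

lemma nn_integral_Q_white_noise:
  assumes "d' > 1/2"
  shows "\<exists>C\<ge>0. \<forall>d. (\<integral>\<^sup>+w. Q d' w \<partial>white_noise L Z a d) \<le> ennreal C"
proof -
  obtain C where C: "C \<ge> 0" "(\<integral>\<^sup>+w. Q d' w \<partial>W) \<le> ennreal C" using nn_integral_Q_W[OF assms] by blast
  have "(\<integral>\<^sup>+w. Q d' w \<partial>white_noise L Z a d) \<le> ennreal C" for d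
  proof -
    have "(\<integral>\<^sup>+w. Q d' w \<partial>white_noise L Z a d) = (\<integral>\<^sup>+w. Q d' w * indicator (space_H L Z a d) w \<partial>W)"
      unfolding white_noise_alt using space_H_sets_W
      by (simp add: nn_integral_distr[OF measurable_id_borel_H] measurable_Q_borel_H nn_integral_restrict_space)
    also have "\<dots> \<le> (\<integral>\<^sup>+w. Q d' w \<partial>W)"
      by (intro nn_integral_mono) (auto simp: indicator_def)
    finally show ?thesis using C by simp
  qed
  with C show ?thesis by blast
qed

lemma white_noise_tail:
  assumes "d' > 1/2"
  shows "\<exists>C\<ge>0. \<forall>d>1/2. \<forall>M>0. emeasure (white_noise L Z a d) {w \<in> space_H L Z a d. ennreal M < Q d' w} \<le> ennreal (C / M)"
proof -
  obtain C where C: "C \<ge> 0" "\<And>d. (\<integral>\<^sup>+w. Q d' w \<partial>white_noise L Z a d) \<le> ennreal C"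
    using nn_integral_Q_white_noise[OF assms] by blast
  have "emeasure (white_noise L Z a d) {w \<in> space_H L Z a d. ennreal M < Q d' w} \<le> ennreal (C / M)"
    if M: "M > 0" for d M
  proof -
    note measurable_Q_borel_H[measurable]
    \<comment> \<open>The event is brought into the form \<open>1 \<le> c * u\<close> in which
      Markov's inequality is stated.\<close>
    have "emeasure (white_noise L Z a d) {w \<in> space_H L Z a d. ennreal M < Q d' w} \<le>
        emeasure (white_noise L Z a d) {w \<in> space_H L Z a d. 1 \<le> ennreal (1 / M) * Q d' w}"
    proof (rule emeasure_mono)
      show "{w \<in> space_H L Z a d. ennreal M < Q d' w} \<subseteq> {w \<in> space_H L Z a d. 1 \<le> ennreal (1 / M) * Q d' w}"
      proof safe
        fix w assume "ennreal M < Q d' w"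
        then have "ennreal (1 / M) * ennreal M \<le> ennreal (1 / M) * Q d' w"
          by (intro mult_left_mono) auto
        then show "1 \<le> ennreal (1 / M) * Q d' w" using M by (simp add: ennreal_mult[symmetric])
      qed
      have "{w \<in> space (borel_H L Z a d). 1 \<le> ennreal (1 / M) * Q d' w} \<in> sets (borel_H L Z a d)"
        by measurable
      then show "{w \<in> space_H L Z a d. 1 \<le> ennreal (1 / M) * Q d' w} \<in> sets (white_noise L Z a d)"
        by simp
    qed
    also have "\<dots> \<le> ennreal (1 / M) * (\<integral>\<^sup>+w. Q d' w * indicator (space_H L Z a d) w \<partial>white_noise L Z a d)"
      by (rule nn_integral_Markov_inequality)
        (use measurable_Q_borel_H[of d' d] sets.top[of "borel_H L Z a d"] in \<open>auto intro!: borel_measurable_times_ennreal simp: measurable_cong_sets[OF sets_white_noise refl]\<close>)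
    also have "\<dots> \<le> ennreal (1 / M) * ennreal C"
      by (intro mult_left_mono order_trans[OF nn_integral_mono C(2)]) (auto simp: indicator_def)
    finally show ?thesis using M C(1) by (simp add: ennreal_mult[symmetric])
  qed
  with C(1) show ?thesis by blast
qed

end

section \<open>Coefficients of functions and projections of white noise\<close>

locale H_basis = H_scale +
  fixes \<psi> :: "int \<Rightarrow> int \<Rightarrow> real \<Rightarrow> real"
  assumes ortho: "\<And>i j. i \<in> I \<Longrightarrow> j \<in> I \<Longrightarrow>
    inner (basis_vec \<psi> i) (basis_vec \<psi> j) = (if i = j then 1 else 0)"
begin

abbreviation e :: "int \<times> int \<Rightarrow> L2" where
  "e \<equiv> basis_vec \<psi>"

lemma norm_e: "i \<in> I \<Longrightarrow> norm (e i) = 1"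
  using ortho[of i i] by (simp add: norm_eq_sqrt_inner)

text \<open>The weights decrease in \<open>a l \<ge> 2\<close>, so they are bounded by their value
  \<open>B\<close> at 2, and Bessel's inequality bounds the rest.\<close>

lemma Q_coeffs_L2:
  assumes "d > 0"
  shows "Q d (coeffs_L2 L Z \<psi> f) < \<top>"
proof -
  define B where "B = inverse 2 * ln 2 powr (-2 * d)"
  have wB: "wt a d l \<le> B" if "l \<in> L" for l
    unfolding wt_def B_def using a_ge_2[OF that] assms
    by (intro mult_mono powr_mono2' le_imp_inverse_le) auto
  have B: "B \<ge> 0" by (simp add: B_def)
  have "Q d (coeffs_L2 L Z \<psi> f) \<le> ennreal (B * (norm f)\<^sup>2)"
  proof (rule Q_le)
    fix m
    have "qsum d m (coeffs_L2 L Z \<psi> f) \<le> (\<Sum>i\<in>Sigma (window m) Z. B * (inner f (e i))\<^sup>2)"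
      unfolding qsum_alt
    proof (rule sum_mono)
      fix i assume "i \<in> Sigma (window m) Z"
      then have i: "i \<in> I" "fst i \<in> L" by (auto dest: windowD)
      then show "wt a d (fst i) * (coeffs_L2 L Z \<psi> f i)\<^sup>2 \<le> B * (inner f (e i))\<^sup>2"
        using mult_right_mono[OF wB[OF i(2)], of "(inner f (e i))\<^sup>2"] by (simp add: coeffs_L2_def)
    qed
    also have "\<dots> \<le> B * (norm f)\<^sup>2"
      unfolding sum_distrib_left[symmetric]
      by (intro mult_left_mono bessel_inequality B finite_window_I ortho) (auto dest: windowD)
    finally show "qsum d m (coeffs_L2 L Z \<psi> f) \<le> B * (norm f)\<^sup>2" .
  qed
  then show ?thesis by (rule order.strict_trans1) simp
qed

lemma coeffs_L2_space_H: "d > 0 \<Longrightarrow> coeffs_L2 L Z \<psi> f \<in> space_H L Z a d"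
  by (simp add: space_H_iff Q_coeffs_L2) (simp add: coeffs_L2_def)

lemma measurable_inner_e: "(\<lambda>f. inner f (e i)) \<in> borel_measurable (borel :: L2 measure)"
  by (intro borel_measurable_continuous_onI continuous_intros)

lemma measurable_coeffs_L2: "d > 0 \<Longrightarrow> coeffs_L2 L Z \<psi> \<in> borel \<rightarrow>\<^sub>M borel_H L Z a d"
  by (rule measurable_borel_H)
    (simp_all only: coeffs_L2_space_H, simp add: coeffs_L2_def measurable_inner_e del: case_prod_conv split_paired_all)

lemma proj_V_Lipschitz:
  assumes "x \<in> space_H L Z a d" "y \<in> space_H L Z a d"
  shows "dist (proj_V (window m) Z \<psi> x) (proj_V (window m) Z \<psi> y) \<le>
    (\<Sum>i\<in>Sigma (window m) Z. inverse (sqrt (wt a d (fst i)))) * dist_H L Z a d x y"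
proof -
  have "dist (proj_V (window m) Z \<psi> x) (proj_V (window m) Z \<psi> y) =
      norm (\<Sum>i\<in>Sigma (window m) Z. (x i - y i) *\<^sub>R e i)"
    by (simp add: dist_norm proj_V_def sum_subtractf scaleR_left_diff_distrib)
  also have "\<dots> \<le> (\<Sum>i\<in>Sigma (window m) Z. inverse (sqrt (wt a d (fst i))) * dist_H L Z a d x y)"
  proof (rule sum_norm_le)
    fix i assume "i \<in> Sigma (window m) Z"
    then have "i \<in> I" by (auto dest: windowD)
    then show "norm ((x i - y i) *\<^sub>R e i) \<le> inverse (sqrt (wt a d (fst i))) * dist_H L Z a d x y"
      using coeff_le_dist_H[OF _ assms] norm_e by simp
  qed
  finally show ?thesis by (simp add: sum_distrib_right)
qed

lemma proj_V_in_V: "proj_V L' Z' \<psi> c \<in> subspace_V L' Z' \<psi>"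
  unfolding proj_V_def subspace_V_def by (intro span_sum span_scale span_base) auto

lemma measurable_proj_V: "proj_V (window m) Z \<psi> \<in> borel_H L Z a d \<rightarrow>\<^sub>M borel_V (window m) Z \<psi>"
  unfolding borel_V_def
  by (intro measurable_restrict_space2 Lipschitz_measurable_borel_H[OF proj_V_Lipschitz])
    (auto simp: proj_V_in_V)

lemma proj_V_cong: "(\<And>i. i \<in> Sigma L' Z' \<Longrightarrow> x i = y i) \<Longrightarrow> proj_V L' Z' \<psi> x = proj_V L' Z' \<psi> y"
  unfolding proj_V_def by (intro sum.cong) auto

text \<open>The projection reads only the coordinates in the window, and the marginal of a product
  measure on finitely many coordinates is the finite product. This identifies the Gaussian limit on
  the subspace as the image of white noise.\<close>

lemma distr_white_noise_proj_V:
  assumes d: "d > 1/2"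
  shows "distr (white_noise L Z a d) (borel_V (window m) Z \<psi>) (proj_V (window m) Z \<psi>) =
    gaussian_V (window m) Z \<psi>"
proof -
  let ?J = "Sigma (window m) Z" and ?V = "borel_V (window m) Z \<psi>" and ?p = "proj_V (window m) Z \<psi>"
  let ?WJ = "PiM ?J (\<lambda>_. std_normal_distribution)"
  have J: "?J \<subseteq> I" by (auto dest: windowD)
  \<comment> \<open>Padding with zeros embeds the finite product into the space, so that
    measurability of the projection there can be reused.\<close>
  have emb: "(\<lambda>c. \<lambda>i\<in>I. trunc m c i) \<in> ?WJ \<rightarrow>\<^sub>M borel_H L Z a d"
  proof (rule measurable_borel_H)
    fix c
    have "Q d (\<lambda>i\<in>I. trunc m c i) = Q d (trunc m c)" by (rule Q_cong) auto
    then show "(\<lambda>i\<in>I. trunc m c i) \<in> space_H L Z a d"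
      by (simp add: space_H_iff trunc_finite)
  next
    fix i assume i: "i \<in> I"
    have "(\<lambda>x. x i) \<in> borel_measurable ?WJ" if "i \<in> ?J"
      using measurable_component_singleton[OF that, of "\<lambda>_. std_normal_distribution"] by simp
    then show "(\<lambda>x. (\<lambda>i\<in>I. trunc m x i) i) \<in> borel_measurable ?WJ"
      using i by (cases "i \<in> ?J") (auto simp: trunc_def)
  qed
  have "(\<lambda>c. ?p (\<lambda>i\<in>I. trunc m c i)) \<in> ?WJ \<rightarrow>\<^sub>M ?V"
    by (rule measurable_compose[OF emb measurable_proj_V])
  moreover have "?p (\<lambda>i\<in>I. trunc m c i) = ?p c" for c
    using J by (intro proj_V_cong) (auto simp: trunc_def)
  ultimately have pJ: "?p \<in> ?WJ \<rightarrow>\<^sub>M ?V" by simp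
  have r: "(\<lambda>w. restrict w ?J) \<in> W \<rightarrow>\<^sub>M ?WJ"
    unfolding W_def by (rule measurable_restrict_subset[OF J])
  have "gaussian_V (window m) Z \<psi> = distr (distr W ?WJ (\<lambda>w. restrict w ?J)) ?V ?p"
    unfolding gaussian_V_def W_def
    by (subst white.distr_PiM_restrict_finite) (auto dest: windowD)
  also have "\<dots> = distr W ?V (\<lambda>w. ?p (restrict w ?J))"
    by (subst distr_distr[OF pJ r]) (simp add: comp_def)
  also have "(\<lambda>w. ?p (restrict w ?J)) = ?p"
    by (intro ext proj_V_cong) auto
  finally have g: "gaussian_V (window m) Z \<psi> = distr W ?V ?p" .
  have pW: "?p \<in> W \<rightarrow>\<^sub>M ?V"
  proof -
    have "(\<lambda>w. ?p (restrict w ?J)) \<in> W \<rightarrow>\<^sub>M ?V" by (rule measurable_compose[OF r pJ])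
    also have "(\<lambda>w. ?p (restrict w ?J)) = ?p" by (intro ext proj_V_cong) auto
    finally show ?thesis .
  qed
  have "distr (white_noise L Z a d) ?V ?p = distr (restrict_space W (space_H L Z a d)) ?V ?p"
    unfolding white_noise_alt by (subst distr_distr[OF measurable_proj_V measurable_id_borel_H]) (simp add: comp_def)
  \<comment> \<open>The trace and the product law have the same image because the space has full
    product measure.\<close>
  also have "\<dots> = distr W ?V ?p"
  proof (rule measure_eqI)
    fix A assume "A \<in> sets (distr (restrict_space W (space_H L Z a d)) ?V ?p)"
    then have A: "A \<in> sets ?V" by simp
    have "emeasure (distr (restrict_space W (space_H L Z a d)) ?V ?p) A =
        emeasure W (?p -` A \<inter> space W \<inter> space_H L Z a d)"
      using A pW space_H_sets_W sets.sets_into_space[OF space_H_sets_W]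
      by (subst emeasure_distr)
        (auto simp: emeasure_restrict_space space_restrict_space
           intro!: measurable_restrict_space1 arg_cong[of _ _ "emeasure W"])
    also have "\<dots> = emeasure W (?p -` A \<inter> space W)"
      using AE_W_space_H[OF d] A pW space_H_sets_W
      by (intro emeasure_eq_AE) (auto simp: measurable_sets)
    also have "\<dots> = emeasure (distr W ?V ?p) A"
      using A pW by (simp add: emeasure_distr)
    finally show "emeasure (distr (restrict_space W (space_H L Z a d)) ?V ?p) A = emeasure (distr W ?V ?p) A" .
  qed simp
  finally show ?thesis using g by simp
qed

lemma measurable_shift:
  assumes "x \<in> space_H L Z a d"
  shows "(\<lambda>w. \<lambda>i\<in>I. x i + w i / sqrt (real n)) \<in> borel_H L Z a d \<rightarrow>\<^sub>M borel_H L Z a d"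
proof (rule measurable_borel_H)
  fix w assume "w \<in> space (borel_H L Z a d)"
  then have w: "Q d w < \<top>" "Q d x < \<top>" using assms by (auto simp: space_H_iff)
  have "Q d (\<lambda>i\<in>I. x i + w i / sqrt (real n)) = Q d (\<lambda>i. x i + inverse (sqrt (real n)) * w i)"
    by (rule Q_cong) (auto simp: field_simps)
  also have "\<dots> < \<top>" by (intro Q_add_finite Q_scale_finite w)
  finally show "(\<lambda>i\<in>I. x i + w i / sqrt (real n)) \<in> space_H L Z a d" by (simp add: space_H_iff)
qed (auto intro: measurable_coeff)

end

section \<open>Bounded Lipschitz and total variation distances\<close>

text \<open>A real supremum dominates its members only over a bounded set; the total masses give the
  bound 2.\<close>

lemma bdd_above_tv_dist:
  assumes "prob_space M" "prob_space N" "sets N = sets M"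
  shows "bdd_above ((\<lambda>C. \<Sum>A\<in>C. \<bar>measure M A - measure N A\<bar>) `
    {C. finite C \<and> C \<subseteq> sets M \<and> partition_on (space M) C})"
proof (rule bdd_aboveI2)
  interpret M: prob_space M by fact
  interpret N: prob_space N by fact
  fix C assume "C \<in> {C. finite C \<and> C \<subseteq> sets M \<and> partition_on (space M) C}"
  then have C: "finite C" "C \<subseteq> sets M" "partition_on (space M) C" by auto
  have dis: "disjoint_family_on (\<lambda>A. A) C"
    using C(3) by (auto simp: partition_on_def disjoint_def disjoint_family_on_def)
  have "(\<Sum>A\<in>C. \<bar>measure M A - measure N A\<bar>) \<le> (\<Sum>A\<in>C. measure M A) + (\<Sum>A\<in>C. measure N A)"
    unfolding sum.distrib[symmetric] by (intro sum_mono) (auto simp: abs_le_iff add_increasing add_increasing2)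
  also have "(\<Sum>A\<in>C. measure M A) = measure M (\<Union>A\<in>C. A)"
    using C dis by (intro M.finite_measure_finite_Union[symmetric]) auto
  also have "(\<Sum>A\<in>C. measure N A) = measure N (\<Union>A\<in>C. A)"
    using C dis assms(3) by (intro N.finite_measure_finite_Union[symmetric]) auto
  finally show "(\<Sum>A\<in>C. \<bar>measure M A - measure N A\<bar>) \<le> 2"
    using M.prob_le_1[of "\<Union>A\<in>C. A"] N.prob_le_1[of "\<Union>A\<in>C. A"] by linarith
qed

text \<open>
  The integrand is approximated by its discretization along the level sets of \<open>\<lfloor>k v\<rfloor>\<close>, which form
  a finite partition.
\<close>

lemma abs_integral_diff_le_tv_dist:
  assumes M: "prob_space M" and N: "prob_space N" and sets: "sets N = sets M"
    and v: "v \<in> borel_measurable M" and bound: "\<And>x. x \<in> space M \<Longrightarrow> \<bar>v x\<bar> \<le> 1"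
  shows "\<bar>(\<integral>x. v x \<partial>M) - (\<integral>x. v x \<partial>N)\<bar> \<le> tv_dist M N"
proof -
  note v[measurable]
  have space: "space N = space M" using sets by (rule sets_eq_imp_space_eq)
  have approx: "\<bar>(\<integral>x. v x \<partial>M) - (\<integral>x. v x \<partial>N)\<bar> \<le> tv_dist M N + 2 / real k" if k: "k \<ge> 1" for k :: nat
  proof -
    define A where "A j = {x \<in> space M. \<lfloor>real k * v x\<rfloor> = j}" for j :: int
    define J where "J = {- int k..int k}"
    define s where "s x = real_of_int \<lfloor>real k * v x\<rfloor> / real k" for x
    have A [measurable]: "A j \<in> sets M" for j unfolding A_def by measurable
    have J: "\<lfloor>real k * v x\<rfloor> \<in> J" if "x \<in> space M" for x
    proof -
      have "real k * \<bar>v x\<bar> \<le> real k * 1" using bound[OF that] by (intro mult_left_mono) auto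
      then have "\<bar>real k * v x\<bar> \<le> real k" by (simp add: abs_mult)
      then show ?thesis unfolding J_def by (simp add: abs_le_iff le_floor_iff floor_le_iff)
    qed
    have int: "\<bar>(\<integral>x. v x \<partial>R) - (\<Sum>j\<in>J. real_of_int j / real k * measure R (A j))\<bar> \<le> 1 / real k"
      if R: "prob_space R" "sets R = sets M" for R
    proof -
      interpret R: prob_space R by (rule R)
      have spR: "space R = space M" using R(2) by (rule sets_eq_imp_space_eq)
      note [measurable_cong] = R(2)
      have s_eq: "s x = (\<Sum>j\<in>J. real_of_int j / real k * indicator (A j) x)" if "x \<in> space M" for x
      proof -
        have "(\<Sum>j\<in>J. real_of_int j / real k * indicator (A j) x) =
            (\<Sum>j\<in>J. if \<lfloor>real k * v x\<rfloor> = j then real_of_int j / real k else 0)"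
          using that by (intro sum.cong) (auto simp: A_def indicator_def)
        also have "\<dots> = s x" using J[OF that] by (subst sum.delta') (auto simp: J_def s_def)
        finally show ?thesis ..
      qed
      have AR: "A j \<in> sets R" for j using A R(2) by simp
      have int_s: "(\<integral>x. s x \<partial>R) = (\<Sum>j\<in>J. real_of_int j / real k * measure R (A j))"
      proof -
        have "(\<integral>x. s x \<partial>R) = (\<integral>x. (\<Sum>j\<in>J. real_of_int j / real k * indicator (A j) x) \<partial>R)"
          using s_eq by (intro Bochner_Integration.integral_cong) (auto simp: spR)
        also have "\<dots> = (\<Sum>j\<in>J. \<integral>x. real_of_int j / real k * indicator (A j) x \<partial>R)"
          by (intro Bochner_Integration.integral_sum integrable_mult_right R.integrable_const_bound[where B=1])
            (auto simp: indicator_def AR intro!: borel_measurable_indicator')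
        also have "\<dots> = (\<Sum>j\<in>J. real_of_int j / real k * measure R (A j))"
          using AR by (simp add: spR Int_absorb2 sets.sets_into_space)
        finally show ?thesis .
      qed
      have sm: "s \<in> borel_measurable R" unfolding s_def by measurable
      have iv: "integrable R v"
        by (rule R.integrable_const_bound[where B=1]) (auto simp: spR bound)
      have close: "\<bar>v x - s x\<bar> \<le> 1 / real k" for x
      proof -
        have "\<bar>real k * v x - real_of_int \<lfloor>real k * v x\<rfloor>\<bar> \<le> 1" by linarith
        then have "\<bar>real k * v x - real_of_int \<lfloor>real k * v x\<rfloor>\<bar> / real k \<le> 1 / real k"
          by (intro divide_right_mono) auto
        moreover have "\<bar>v x - s x\<bar> = \<bar>(real k * v x - real_of_int \<lfloor>real k * v x\<rfloor>) / real k\<bar>"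
          using k by (intro arg_cong[of _ _ abs]) (simp add: s_def diff_divide_distrib)
        ultimately show ?thesis by (simp only: abs_divide abs_of_nat)
      qed
      have ivs: "integrable R (\<lambda>x. v x - s x)"
        by (rule R.integrable_const_bound[where B="1 / real k"]) (use close sm in auto)
      have isx: "integrable R s"
        using Bochner_Integration.integrable_diff[OF iv ivs] by (simp only: diff_diff_eq2 add_diff_cancel_left')
      have "\<bar>(\<integral>x. v x \<partial>R) - (\<integral>x. s x \<partial>R)\<bar> = \<bar>\<integral>x. v x - s x \<partial>R\<bar>"
        by (simp add: iv isx)
      also have "\<dots> \<le> (\<integral>x. \<bar>v x - s x\<bar> \<partial>R)" by (rule integral_abs_bound)
      also have "\<dots> \<le> (\<integral>x. 1 / real k \<partial>R)"
        by (intro integral_mono integrable_abs ivs close) simp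
      also have "\<dots> = 1 / real k" by (simp add: R.prob_space)
      finally show ?thesis unfolding int_s .
    qed
    \<comment> \<open>A partition has no empty blocks, so empty level sets are dropped; on the
      remaining indices \<open>A\<close> is injective and the sum can be reindexed by
      blocks.\<close>
    define J' where "J' = {j \<in> J. A j \<noteq> {}}"
    have inj: "inj_on A J'" by (auto simp: inj_on_def J'_def A_def)
    have "\<bar>(\<Sum>j\<in>J. real_of_int j / real k * measure M (A j)) - (\<Sum>j\<in>J. real_of_int j / real k * measure N (A j))\<bar>
        = \<bar>\<Sum>j\<in>J. real_of_int j / real k * (measure M (A j) - measure N (A j))\<bar>"
      by (simp add: sum_subtractf right_diff_distrib)
    also have "\<dots> \<le> (\<Sum>j\<in>J. \<bar>measure M (A j) - measure N (A j)\<bar>)"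
    proof (rule order_trans[OF sum_abs], rule sum_mono)
      fix j assume "j \<in> J"
      then have "\<bar>real_of_int j / real k\<bar> \<le> 1" using k by (auto simp: J_def abs_le_iff divide_simps)
      then show "\<bar>real_of_int j / real k * (measure M (A j) - measure N (A j))\<bar> \<le> \<bar>measure M (A j) - measure N (A j)\<bar>"
        unfolding abs_mult by (intro mult_left_le_one_le) auto
    qed
    also have "\<dots> = (\<Sum>j\<in>J'. \<bar>measure M (A j) - measure N (A j)\<bar>)"
      by (intro sum.mono_neutral_right) (auto simp: J'_def J_def)
    also have "\<dots> = (\<Sum>B\<in>A ` J'. \<bar>measure M B - measure N B\<bar>)"
      using inj by (simp add: sum.reindex)
    also have "\<dots> \<le> tv_dist M N"
      unfolding tv_dist_def
    proof (rule cSUP_upper[OF _ bdd_above_tv_dist[OF M N sets]])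
      have "partition_on (space M) (A ` J')"
        using J by (intro partition_onI) (auto simp: J'_def A_def disjnt_def)
      moreover have "finite J'" unfolding J'_def by (rule finite_subset[of _ J]) (auto simp: J_def)
      ultimately show "A ` J' \<in> {C. finite C \<and> C \<subseteq> sets M \<and> partition_on (space M) C}"
        by (auto intro: finite_imageI)
    qed
    finally show ?thesis
      using int[OF M refl] int[OF N sets] by linarith
  qed
  show ?thesis
  proof (rule field_le_epsilon)
    fix \<epsilon> :: real assume "\<epsilon> > 0"
    then obtain n where n: "1 / real (Suc n) < \<epsilon> / 2"
      using nat_approx_posE[of "\<epsilon> / 2"] by (metis half_gt_zero)
    have "\<bar>(\<integral>x. v x \<partial>M) - (\<integral>x. v x \<partial>N)\<bar> \<le> tv_dist M N + 2 * (1 / real (Suc n))"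
      using approx[of "Suc n"] by simp
    then show "\<bar>(\<integral>x. v x \<partial>M) - (\<integral>x. v x \<partial>N)\<bar> \<le> tv_dist M N + \<epsilon>" using n by linarith
  qed
qed

section \<open>Bounded Lipschitz functions and truncation\<close>

context H_scale
begin

lemma BL1_measurable: "u \<in> BL1_H L Z a d \<Longrightarrow> u \<in> borel_measurable (borel_H L Z a d)"
proof -
  assume "u \<in> BL1_H L Z a d"
  then obtain t where
    "\<forall>x\<in>space_H L Z a d. \<forall>y\<in>space_H L Z a d. \<bar>u x - u y\<bar> \<le> t * dist_H L Z a d x y"
    by (auto simp: BL1_H_def)
  then show ?thesis
    by (intro Lipschitz_measurable_borel_H[of _ _ t]) (auto simp: dist_real_def)
qed

lemma BL1_D:
  assumes "u \<in> BL1_H L Z a d" "x \<in> space_H L Z a d"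
  shows "\<bar>u x\<bar> \<le> 1" "y \<in> space_H L Z a d \<Longrightarrow> \<bar>u x - u y\<bar> \<le> dist_H L Z a d x y"
proof -
  obtain s t where st: "0 \<le> s" "0 \<le> t" "s + t \<le> 1" "\<bar>u x\<bar> \<le> s"
    "\<forall>y\<in>space_H L Z a d. \<bar>u x - u y\<bar> \<le> t * dist_H L Z a d x y"
    using assms by (auto simp: BL1_H_def)
  show "\<bar>u x\<bar> \<le> 1" using st by linarith
  show "\<bar>u x - u y\<bar> \<le> dist_H L Z a d x y" if y: "y \<in> space_H L Z a d"
  proof -
    have "\<bar>u x - u y\<bar> \<le> t * dist_H L Z a d x y" using st(5) y by blast
    also have "\<dots> \<le> 1 * dist_H L Z a d x y"
      using st norm_H_nonneg by (intro mult_right_mono) (auto simp: dist_H_def)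
    finally show ?thesis by simp
  qed
qed

lemma zero_BL1: "(\<lambda>_. 0) \<in> BL1_H L Z a d"
  using norm_H_nonneg unfolding BL1_H_def
  by (auto simp: dist_H_def intro!: exI[of _ "0::real"])

definition truncate :: "nat \<Rightarrow> (int \<times> int \<Rightarrow> real) \<Rightarrow> int \<times> int \<Rightarrow> real" where
  "truncate m c = (\<lambda>i\<in>I. trunc m c i)"

lemma truncate_space_H: "truncate m c \<in> space_H L Z a d"
proof -
  have "Q d (truncate m c) = Q d (trunc m c)" by (rule Q_cong) (auto simp: truncate_def)
  then show ?thesis by (simp add: space_H_iff trunc_finite truncate_def)
qed

lemma measurable_truncate: "truncate m \<in> borel_H L Z a d \<rightarrow>\<^sub>M borel_H L Z a d"
  by (rule measurable_borel_H[OF truncate_space_H])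
    (auto simp: truncate_def trunc_def dest: windowD intro!: measurable_coeff measurable_If)

text \<open>The two weights differ by the factor \<open>ln (a l) powr (-2 * (d - d'))\<close>, which
  is small at all levels that the truncation removes: the gap between the exponents is traded for
  smallness.\<close>

lemma dist_H_truncate:
  assumes y: "y \<in> space_H L Z a d" and d: "d' < d" and m: "1 \<le> m" and Q: "Q d' y \<le> ennreal M" and M: "0 \<le> M"
  shows "dist_H L Z a d y (truncate m y) \<le> sqrt (ln (real m + 1) powr (-2 * (d - d')) * M)"
proof -
  define \<eta> where "\<eta> = ln (real m + 1) powr (-2 * (d - d'))"
  have \<eta>: "\<eta> \<ge> 0" by (simp add: \<eta>_def)
  have w: "wt a d l \<le> \<eta> * wt a d' l" if l: "l \<in> L" "l \<notin> window m" for l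
  proof -
    \<comment> \<open>Levels are integers, so \<open>\<bar>l\<bar> > m\<close> gains one; with
      \<open>1 \<le> m\<close> this keeps the logarithm positive, as antitonicity of the negative
      power requires.\<close>
    have "real m + 1 \<le> real_of_int \<bar>l\<bar>"
    proof -
      have "int m + 1 \<le> \<bar>l\<bar>" using l by (auto simp: window_def)
      then have "real_of_int (int m + 1) \<le> real_of_int \<bar>l\<bar>" by (subst of_int_le_iff)
      then show ?thesis by simp
    qed
    also have "\<dots> \<le> a l" using a_ge_abs l by blast
    finally have al: "real m + 1 \<le> a l" .
    have "wt a d l = ln (a l) powr (-2 * (d - d')) * wt a d' l"
      by (simp add: wt_def powr_add[symmetric] algebra_simps)
    also have "\<dots> \<le> \<eta> * wt a d' l"
      unfolding \<eta>_def using al m d wt_nonneg[OF l(1)]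
      by (intro mult_right_mono powr_mono2') auto
    finally show ?thesis .
  qed
  have "Q d (\<lambda>i. y i - truncate m y i) \<le> ennreal (\<eta> * M)"
  proof (rule Q_le)
    fix k
    have "qsum d k (\<lambda>i. y i - truncate m y i) \<le> \<eta> * qsum d' k y"
      unfolding qsum_alt sum_distrib_left
    proof (rule sum_mono)
      fix i assume "i \<in> Sigma (window k) Z"
      then have i: "i \<in> I" "fst i \<in> L" "snd i \<in> Z (fst i)" by (auto dest: windowD)
      show "wt a d (fst i) * (y i - truncate m y i)\<^sup>2 \<le> \<eta> * (wt a d' (fst i) * (y i)\<^sup>2)"
      proof (cases "fst i \<in> window m")
        case True
        then have "truncate m y i = y i" using i by (cases i) (auto simp: truncate_def trunc_def)
        then show ?thesis using \<eta> wt_nonneg[OF i(2)] by simp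
      next
        case False
        then have "truncate m y i = 0" using i by (cases i) (auto simp: truncate_def trunc_def)
        then show ?thesis
          using mult_right_mono[OF w[OF i(2) False], of "(y i)\<^sup>2"] by (simp add: mult.assoc)
      qed
    qed
    also have "\<dots> \<le> \<eta> * M"
    proof (rule mult_left_mono[OF _ \<eta>])
      have "ennreal (qsum d' k y) \<le> ennreal M" using qsum_le_Q Q by (rule order_trans)
      then show "qsum d' k y \<le> M" using M by simp
    qed
    finally show "qsum d k (\<lambda>i. y i - truncate m y i) \<le> \<eta> * M" .
  qed
  moreover have "Q d (\<lambda>i. y i - truncate m y i) < \<top>"
    using y truncate_space_H[of m y d] by (intro Q_diff_finite) (auto simp: space_H_iff)
  ultimately show ?thesis
    unfolding dist_H_def \<eta>_def[symmetric] using \<eta> M by (subst norm_H_le_iff) auto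
qed

text \<open>Outside the ball two values bounded by 1 differ by at most 2; inside it the Lipschitz
  constant is at most 1 and the truncation error is uniform.\<close>

lemma BL1_truncate_integral:
  assumes P: "prob_space P" "sets P = sets (borel_H L Z a d)" and u: "u \<in> BL1_H L Z a d"
    and d: "d' < d" and m: "1 \<le> m" and M: "0 \<le> M"
  shows "\<bar>(\<integral>y. u y \<partial>P) - (\<integral>y. u (truncate m y) \<partial>P)\<bar> \<le>
    2 * measure P {y \<in> space_H L Z a d. ennreal M < Q d' y} +
      sqrt (ln (real m + 1) powr (-2 * (d - d')) * M)"
proof -
  interpret P: prob_space P by (rule P)
  have sp: "space P = space_H L Z a d" using sets_eq_imp_space_eq[OF P(2)] by simp
  define s where "s = sqrt (ln (real m + 1) powr (-2 * (d - d')) * M)"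
  define A where "A = {y \<in> space_H L Z a d. ennreal M < Q d' y}"
  note [measurable_cong] = P(2)
  note [measurable] = measurable_Q_borel_H BL1_measurable[OF u] measurable_compose[OF measurable_truncate BL1_measurable[OF u]]
  have "{y \<in> space (borel_H L Z a d). ennreal M < Q d' y} \<in> sets (borel_H L Z a d)" by measurable
  then have A: "A \<in> sets P" by (simp add: A_def P(2))
  have s: "s \<ge> 0" using M by (simp add: s_def)
  have i1: "integrable P u"
    by (rule P.integrable_const_bound[where B=1]) (use BL1_D(1)[OF u] in \<open>auto simp: sp\<close>)
  have i2: "integrable P (\<lambda>y. u (truncate m y))"
    by (rule P.integrable_const_bound[where B=1]) (use BL1_D(1)[OF u truncate_space_H] in \<open>auto simp: sp\<close>)
  have i3: "integrable P (\<lambda>y. 2 * indicator A y :: real)"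
    using A by (intro integrable_mult_right integrable_real_indicator) (auto simp: P.emeasure_eq_measure)
  have "\<bar>(\<integral>y. u y \<partial>P) - (\<integral>y. u (truncate m y) \<partial>P)\<bar> = \<bar>\<integral>y. u y - u (truncate m y) \<partial>P\<bar>"
    by (simp add: i1 i2)
  also have "\<dots> \<le> (\<integral>y. \<bar>u y - u (truncate m y)\<bar> \<partial>P)" by (rule integral_abs_bound)
  also have "\<dots> \<le> (\<integral>y. 2 * indicator A y + s \<partial>P)"
  proof (rule integral_mono)
    fix y assume "y \<in> space P"
    then have y: "y \<in> space_H L Z a d" by (simp add: sp)
    show "\<bar>u y - u (truncate m y)\<bar> \<le> 2 * indicator A y + s"
    proof (cases "y \<in> A")
      case True
      then show ?thesis using s BL1_D(1)[OF u y] BL1_D(1)[OF u truncate_space_H[of m y]] by simp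
    next
      case False
      then have "Q d' y \<le> ennreal M" using y by (auto simp: A_def)
      then show ?thesis
        using BL1_D(2)[OF u y truncate_space_H[of m y]] dist_H_truncate[OF y d m _ M] False by (simp add: s_def)
    qed
  qed (use i1 i2 i3 in auto)
  also have "\<dots> = 2 * measure P A + s"
    using i3 A by (simp add: P.prob_space sets.sets_into_space Int_absorb2)
  finally show ?thesis by (simp add: A_def s_def)
qed

end

context H_basis
begin

text \<open>A test function of \<open>truncate m y\<close> thus depends on \<open>y\<close> only
  through its projection, which moves the comparison of integrals to the subspace.\<close>

lemma coeffs_proj_V: "coeffs_L2 L Z \<psi> (proj_V (window m) Z \<psi> y) = truncate m y"
proof
  fix j
  show "coeffs_L2 L Z \<psi> (proj_V (window m) Z \<psi> y) j = truncate m y j"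
  proof (cases "j \<in> I")
    case True
    have "inner (proj_V (window m) Z \<psi> y) (e j) = (\<Sum>i\<in>Sigma (window m) Z. y i * inner (e i) (e j))"
      by (simp add: proj_V_def inner_sum_left)
    also have "\<dots> = (\<Sum>i\<in>Sigma (window m) Z. if i = j then y i else 0)"
    proof (rule sum.cong[OF refl])
      fix i assume "i \<in> Sigma (window m) Z"
      then have "i \<in> I" by (auto dest: windowD)
      then show "y i * inner (e i) (e j) = (if i = j then y i else 0)" using ortho[OF _ True] by simp
    qed
    also have "\<dots> = trunc m y j" by (simp add: trunc_def del: mem_Sigma_iff)
    finally show ?thesis using True by (simp only: coeffs_L2_def truncate_def restrict_apply if_True)
  qed (simp only: coeffs_L2_def truncate_def restrict_apply if_False)
qed

text \<open>Each law is compared with its truncation, which costs a tail mass and a truncation error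
  for each of the two, and the truncated laws are compared on the subspace.\<close>

lemma beta_H_le:
  assumes P: "prob_space P" "sets P = sets (borel_H L Z a d)"
    and d: "d' < d" "1/2 < d" and m: "1 \<le> m" and M: "0 \<le> M"
  shows "\<bar>beta_H L Z a d P (white_noise L Z a d)\<bar> \<le>
    2 * measure P {y \<in> space_H L Z a d. ennreal M < Q d' y} +
    2 * measure (white_noise L Z a d) {y \<in> space_H L Z a d. ennreal M < Q d' y} +
    2 * sqrt (ln (real m + 1) powr (-2 * (d - d')) * M) +
    tv_dist (distr P (borel_V (window m) Z \<psi>) (proj_V (window m) Z \<psi>)) (gaussian_V (window m) Z \<psi>)"
    (is "_ \<le> ?B")
proof -
  let ?N = "white_noise L Z a d" and ?V = "borel_V (window m) Z \<psi>" and ?p = "proj_V (window m) Z \<psi>"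
  have N: "prob_space ?N" by (rule prob_space_white_noise[OF d(2)])
  have le: "\<bar>(\<integral>y. u y \<partial>P) - (\<integral>y. u y \<partial>?N)\<bar> \<le> ?B" if u: "u \<in> BL1_H L Z a d" for u
  proof -
    define v where "v h = u (coeffs_L2 L Z \<psi> h)" for h
    have v: "v \<in> borel_measurable ?V"
      unfolding v_def borel_V_def using d
      by (intro measurable_restrict_space1 measurable_compose[OF measurable_coeffs_L2 BL1_measurable[OF u]]) auto
    have tr: "(\<integral>y. u (truncate m y) \<partial>R) = (\<integral>h. v h \<partial>distr R ?V ?p)"
      if "sets R = sets (borel_H L Z a d)" for R
    proof -
      have "?p \<in> R \<rightarrow>\<^sub>M ?V"
        using measurable_proj_V measurable_cong_sets[OF that refl] by blast
      then show ?thesis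
        using v by (subst integral_distr) (auto simp: v_def coeffs_proj_V)
    qed
    have pr: "prob_space (distr R ?V ?p)" if "prob_space R" "sets R = sets (borel_H L Z a d)" for R
      using that measurable_proj_V measurable_cong_sets[OF that(2) refl]
      by (intro prob_space.prob_space_distr) blast+
    have "\<bar>(\<integral>h. v h \<partial>distr P ?V ?p) - (\<integral>h. v h \<partial>distr ?N ?V ?p)\<bar> \<le> tv_dist (distr P ?V ?p) (distr ?N ?V ?p)"
    proof (intro abs_integral_diff_le_tv_dist pr P N)
      show "\<bar>v h\<bar> \<le> 1" for h
        using d BL1_D(1)[OF u coeffs_L2_space_H] by (simp add: v_def)
    qed (use v in simp_all)
    then have "\<bar>(\<integral>y. u (truncate m y) \<partial>P) - (\<integral>y. u (truncate m y) \<partial>?N)\<bar> \<le>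
        tv_dist (distr P ?V ?p) (gaussian_V (window m) Z \<psi>)"
      by (simp add: tr P(2) distr_white_noise_proj_V[OF d(2)])
    then show ?thesis
      using BL1_truncate_integral[OF P u d(1) m M] BL1_truncate_integral[OF N sets_white_noise u d(1) m M]
      by linarith
  qed
  have "beta_H L Z a d P ?N \<le> ?B"
    unfolding beta_H_def using zero_BL1 le by (intro cSUP_least) auto
  \<comment> \<open>Nonnegativity removes the absolute value. As the supremum is a real one, its
    boundedness is needed here, and \<open>le\<close> supplies it.\<close>
  moreover have "0 \<le> beta_H L Z a d P ?N"
    unfolding beta_H_def
  proof (rule cSUP_upper2[OF _ zero_BL1])
    show "bdd_above ((\<lambda>u. \<bar>(\<integral>y. u y \<partial>P) - (\<integral>y. u y \<partial>?N)\<bar>) ` BL1_H L Z a d)"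
      using le by (intro bdd_aboveI2)
  qed simp
  ultimately show ?thesis by simp
qed

section \<open>Rescaling around the observation\<close>

lemma measurable_Q_coeffs: "(\<lambda>f. Q d (coeffs_L2 L Z \<psi> (f - f\<^sub>0))) \<in> borel_measurable borel"
proof (rule measurable_Q)
  fix i assume "i \<in> I"
  then have "(\<lambda>f. coeffs_L2 L Z \<psi> (f - f\<^sub>0) i) = (\<lambda>f. inner (f - f\<^sub>0) (e i))"
    by (auto simp: coeffs_L2_def)
  also have "\<dots> \<in> borel_measurable borel"
    by (intro borel_measurable_continuous_onI continuous_intros)
  finally show "(\<lambda>f. coeffs_L2 L Z \<psi> (f - f\<^sub>0) i) \<in> borel_measurable borel" .
qed

text \<open>Coefficients of square-integrable functions always lie in the space, so here
  \<open>norm_H\<close> takes no junk value and the contraction hypothesis can be read in terms of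
  \<open>Q\<close>.\<close>

lemma norm_H_coeffs_less_iff:
  assumes "d > 0" "r \<ge> 0"
  shows "r < (norm_H L Z a d (coeffs_L2 L Z \<psi> f))\<^sup>2 \<longleftrightarrow> ennreal r < Q d (coeffs_L2 L Z \<psi> f)"
  using norm_H_Q[OF Q_coeffs_L2[OF assms(1)], of f] assms(2) by (metis ennreal_less_iff)

lemma tau_space_H:
  assumes "d > 0" "x \<in> space_H L Z a d"
  shows "tau L Z n x (coeffs_L2 L Z \<psi> f) \<in> space_H L Z a d"
proof -
  have "Q d (tau L Z n x (coeffs_L2 L Z \<psi> f)) =
      Q d (\<lambda>i. sqrt (real n) * (coeffs_L2 L Z \<psi> f i - x i))"
    by (rule Q_cong) (auto simp: tau_def)
  also have "\<dots> < \<top>"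
    using assms by (intro Q_scale_finite Q_diff_finite Q_coeffs_L2) (auto simp: space_H_iff)
  finally show ?thesis by (simp add: space_H_iff tau_def)
qed

lemma measurable_tau:
  assumes "d > 0" "x \<in> space_H L Z a d"
  shows "(\<lambda>f. tau L Z n x (coeffs_L2 L Z \<psi> f)) \<in> borel \<rightarrow>\<^sub>M borel_H L Z a d"
proof (rule measurable_borel_H[OF tau_space_H[OF assms]])
  fix i assume "i \<in> I"
  then have "(\<lambda>f. tau L Z n x (coeffs_L2 L Z \<psi> f) i) = (\<lambda>f. sqrt (real n) * (inner f (e i) - x i))"
    by (auto simp: tau_def coeffs_L2_def)
  also have "\<dots> \<in> borel_measurable borel"
    by (intro borel_measurable_times borel_measurable_diff measurable_inner_e) auto
  finally show "(\<lambda>f. tau L Z n x (coeffs_L2 L Z \<psi> f) i) \<in> borel_measurable borel" .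
qed

lemma proj_V_tau:
  "proj_V (window m) Z \<psi> (tau L Z n x (coeffs_L2 L Z \<psi> f)) = T_V L Z (window m) Z \<psi> n x f"
  unfolding T_V_def proj_V_def scaleR_sum_right
proof (rule sum.cong[OF refl])
  fix i assume "i \<in> Sigma (window m) Z"
  then have "i \<in> I" by (auto dest: windowD)
  then show "tau L Z n x (coeffs_L2 L Z \<psi> f) i *\<^sub>R e i =
      sqrt (real n) *\<^sub>R (coeffs_L2 L Z \<psi> f i - x i) *\<^sub>R e i"
    by (simp only: tau_def restrict_apply if_True scaleR_scaleR)
qed

text \<open>Inserting \<open>f\<^sub>0\<close> splits the rescaled difference into a part governed
  by contraction and a part that does not depend on \<open>f\<close>.\<close>

lemma Q_tau_le:
  "Q d (tau L Z n x (coeffs_L2 L Z \<psi> f)) \<le>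
    2 * (ennreal (real n) * Q d (coeffs_L2 L Z \<psi> (f - f\<^sub>0))) +
    2 * Q d (\<lambda>i. sqrt (real n) * (coeffs_L2 L Z \<psi> f\<^sub>0 i - x i))"
proof -
  have "Q d (tau L Z n x (coeffs_L2 L Z \<psi> f)) =
      Q d (\<lambda>i. sqrt (real n) * coeffs_L2 L Z \<psi> (f - f\<^sub>0) i +
        sqrt (real n) * (coeffs_L2 L Z \<psi> f\<^sub>0 i - x i))"
    by (rule Q_cong) (simp add: tau_def coeffs_L2_def inner_diff_left algebra_simps del: case_prod_conv)
  also have "\<dots> \<le> 2 * Q d (\<lambda>i. sqrt (real n) * coeffs_L2 L Z \<psi> (f - f\<^sub>0) i) +
      2 * Q d (\<lambda>i. sqrt (real n) * (coeffs_L2 L Z \<psi> f\<^sub>0 i - x i))"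
    by (rule Q_add)
  finally show ?thesis by (simp add: Q_scale)
qed

lemma sets_data_law [simp]: "sets (data_law L Z \<psi> a d n f\<^sub>0) = sets (borel_H L Z a d)"
  and space_data_law [simp]: "space (data_law L Z \<psi> a d n f\<^sub>0) = space_H L Z a d"
  by (simp_all add: data_law_def)

text \<open>Under the data law the rescaled difference is the negative of the noise, and
  \<open>Q\<close> is even; the probability is therefore the same for all
  \<open>n \<ge> 1\<close>.\<close>

lemma data_law_noise:
  assumes d: "d > 0" and n: "n \<ge> 1"
  shows "emeasure (data_law L Z \<psi> a d n f\<^sub>0)
      {x \<in> space_H L Z a d. ennreal r < Q d' (\<lambda>i. sqrt (real n) * (coeffs_L2 L Z \<psi> f\<^sub>0 i - x i))} =
    emeasure (white_noise L Z a d) {w \<in> space_H L Z a d. ennreal r < Q d' w}" (is "emeasure _ ?A = _")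
    and data_law_noise_sets:
      "{x \<in> space_H L Z a d. ennreal r < Q d' (\<lambda>i. sqrt (real n) * (coeffs_L2 L Z \<psi> f\<^sub>0 i - x i))}
        \<in> sets (borel_H L Z a d)"
proof -
  have [measurable]: "(\<lambda>x. Q d' (\<lambda>i. sqrt (real n) * (coeffs_L2 L Z \<psi> f\<^sub>0 i - x i)))
      \<in> borel_measurable (borel_H L Z a d)"
    by (intro measurable_Q borel_measurable_times borel_measurable_diff measurable_coeff) auto
  have "{x \<in> space (borel_H L Z a d). ennreal r < Q d' (\<lambda>i. sqrt (real n) * (coeffs_L2 L Z \<psi> f\<^sub>0 i - x i))}
      \<in> sets (borel_H L Z a d)"
    by measurable
  then show A: "?A \<in> sets (borel_H L Z a d)" by simp
  let ?s = "\<lambda>w. \<lambda>i\<in>I. coeffs_L2 L Z \<psi> f\<^sub>0 i + w i / sqrt (real n)"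
  have s: "?s \<in> white_noise L Z a d \<rightarrow>\<^sub>M borel_H L Z a d"
    using measurable_shift[OF coeffs_L2_space_H[OF d]] by (simp add: measurable_cong_sets[OF sets_white_noise refl])
  have Qs: "Q d' (\<lambda>i. sqrt (real n) * (coeffs_L2 L Z \<psi> f\<^sub>0 i - ?s w i)) = Q d' w" for w
  proof -
    have "Q d' (\<lambda>i. sqrt (real n) * (coeffs_L2 L Z \<psi> f\<^sub>0 i - ?s w i)) = Q d' (\<lambda>i. - w i)"
      using n by (intro Q_cong) (auto simp: field_simps)
    then show ?thesis by (simp add: Q_minus)
  qed
  have "emeasure (data_law L Z \<psi> a d n f\<^sub>0) ?A =
      emeasure (white_noise L Z a d) (?s -` ?A \<inter> space (white_noise L Z a d))"
    unfolding data_law_def by (rule emeasure_distr[OF s A])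
  also have "?s -` ?A \<inter> space (white_noise L Z a d) = {w \<in> space_H L Z a d. ennreal r < Q d' w}"
    unfolding vimage_def mem_Collect_eq Qs using measurable_space[OF s] by auto
  finally show "emeasure (data_law L Z \<psi> a d n f\<^sub>0) ?A =
      emeasure (white_noise L Z a d) {w \<in> space_H L Z a d. ennreal r < Q d' w}" .
qed

end

section \<open>Convergence of the posterior\<close>

lemma ex_small_log_powr:
  fixes M s r :: real
  assumes "s > 0" "r > 0"
  shows "\<exists>m\<ge>1::nat. sqrt (ln (real m + 1) powr (-2 * s) * M) < r"
proof -
  have "filterlim (\<lambda>m::nat. ln (real m + 1)) at_top sequentially"
    by (intro filterlim_compose[OF ln_at_top] filterlim_at_top_mono[OF filterlim_real_sequentially]) auto
  then have "((\<lambda>m::nat. ln (real m + 1) powr (-2 * s)) \<longlongrightarrow> 0) sequentially"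
    using assms by (intro tendsto_neg_powr) auto
  then have "((\<lambda>m::nat. sqrt (ln (real m + 1) powr (-2 * s) * M)) \<longlongrightarrow> sqrt (0 * M)) sequentially"
    by (intro tendsto_intros)
  then have "\<forall>\<^sub>F m in sequentially. sqrt (ln (real m + 1) powr (-2 * s) * M) < r"
    using assms by (intro order_tendstoD(2)) auto
  then have "\<forall>\<^sub>F m in sequentially. sqrt (ln (real m + 1) powr (-2 * s) * M) < r \<and> 1 \<le> m"
    using eventually_ge_at_top by (rule eventually_conj)
  then show ?thesis by (auto simp: eventually_sequentially)
qed

theorem theorem8:
  fixes S :: nat and L :: "int set" and Z :: "int \<Rightarrow> int set"
    and \<psi> :: "int \<Rightarrow> int \<Rightarrow> real \<Rightarrow> real" and a :: "int \<Rightarrow> real"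
    and \<delta> \<delta>' :: real and f\<^sub>0 :: L2 and \<mu> :: "L2 measure"
    and K :: "nat \<Rightarrow> (int \<times> int \<Rightarrow> real) \<Rightarrow> L2 measure"
  assumes S: "1 \<le> S"
    and basis: "regular_basis S L Z \<psi> a"
    and \<delta>: "\<delta> > \<delta>'" "\<delta>' > 1/2"
    and prior: "prob_space \<mu>" "sets \<mu> = sets borel"
    and posterior: "\<And>n. n \<ge> 1 \<Longrightarrow> is_posterior L Z \<psi> a \<delta> \<mu> n (K n)"
    and concentration:
      "\<forall>\<epsilon>>0. \<exists>M>0. \<forall>n\<ge>1.
         (\<integral>\<^sup>+x. emeasure (K n x) {f. (norm_H L Z a \<delta>' (coeffs_L2 L Z \<psi> (f - f\<^sub>0)))\<^sup>2 > M / real n}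
            \<partial>data_law L Z \<psi> a \<delta> n f\<^sub>0) \<le> ennreal \<epsilon>"
    and finite_dim:
      "\<And>L' Z'. finite L' \<Longrightarrow> L' \<subseteq> L \<Longrightarrow> (\<forall>l\<in>L'. finite (Z' l) \<and> Z' l \<subseteq> Z l) \<Longrightarrow>
         tendsto_zero_in_prob (\<lambda>n. data_law L Z \<psi> a \<delta> n f\<^sub>0)
           (\<lambda>n x. tv_dist (distr (K n x) (borel_V L' Z' \<psi>) (T_V L Z L' Z' \<psi> n x))
                    (gaussian_V L' Z' \<psi>))"
  shows "tendsto_zero_in_prob (\<lambda>n. data_law L Z \<psi> a \<delta> n f\<^sub>0)
           (\<lambda>n x. beta_H L Z a \<delta>
                    (distr (K n x) (borel_H L Z a \<delta>) (\<lambda>f. tau L Z n x (coeffs_L2 L Z \<psi> f)))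
                    (white_noise L Z a \<delta>))"
proof -
  interpret H_scale L Z a by (rule H_scale_regular_basis[OF basis])
  interpret H_basis L Z a \<psi>
    using basis by unfold_locales (simp only: regular_basis_def orthonormal_basis_def)
  have d: "\<delta> > 0" "\<delta> > 1/2" "\<delta>' > 0" using \<delta> by auto
  let ?P = "\<lambda>n. data_law L Z \<psi> a \<delta> n f\<^sub>0" and ?N = "white_noise L Z a \<delta>"
  let ?R = "\<lambda>n x. distr (K n x) (borel_H L Z a \<delta>) (\<lambda>f. tau L Z n x (coeffs_L2 L Z \<psi> f))"
  let ?\<beta> = "\<lambda>n x. beta_H L Z a \<delta> (?R n x) ?N"
  let ?F = "\<lambda>M n. {f. (norm_H L Z a \<delta>' (coeffs_L2 L Z \<psi> (f - f\<^sub>0)))\<^sup>2 > M / real n}"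
  obtain C where C: "C \<ge> 0"
    "\<And>M. M > 0 \<Longrightarrow> emeasure ?N {w \<in> space_H L Z a \<delta>. ennreal M < Q \<delta>' w} \<le> ennreal (C / M)"
    using white_noise_tail[OF \<delta>(2)] d(2) by blast
  have N: "prob_space ?N" by (rule prob_space_white_noise[OF d(2)])
  have K: "K n \<in> borel_H L Z a \<delta> \<rightarrow>\<^sub>M prob_algebra borel" if "n \<ge> 1" for n
    using posterior[OF that] by (simp add: is_posterior_def)
  have Kx: "prob_space (K n x)" "sets (K n x) = sets borel" if "n \<ge> 1" "x \<in> space_H L Z a \<delta>" for n x
    using measurable_space[OF K[OF that(1)], of x] that(2) by (auto simp: space_prob_algebra)
  have F: "?F M n = {f \<in> space borel. ennreal (M / real n) < Q \<delta>' (coeffs_L2 L Z \<psi> (f - f\<^sub>0))}"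
    if "M \<ge> 0" for M n
    using that by (simp add: norm_H_coeffs_less_iff d)
  have F_sets: "?F M n \<in> sets borel" if "M \<ge> 0" for M n
    unfolding F[OF that] using measurable_Q_coeffs[measurable] by measurable
  have key: "\<forall>\<^sub>F n in sequentially. outer_measure_of (?P n) {x \<in> space (?P n). \<epsilon> < \<bar>?\<beta> n x\<bar>} \<le> ennreal \<gamma>"
    if \<epsilon>: "\<epsilon> > 0" and \<gamma>: "\<gamma> > 0" for \<epsilon> \<gamma>
  proof -
    \<comment> \<open>By Markov's inequality an expected mass of at most
      \<open>\<epsilon> / 8 * (\<gamma> / 4)\<close> means mass below \<open>\<epsilon> / 8\<close>
      off an event of probability at most \<open>\<gamma> / 4\<close>.\<close>
    obtain M0 where M0: "M0 > 0"
      "\<And>n. n \<ge> 1 \<Longrightarrow> (\<integral>\<^sup>+x. emeasure (K n x) (?F M0 n) \<partial>?P n) \<le> ennreal (\<epsilon> / 8 * (\<gamma> / 4))"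
      using concentration[rule_format, of "\<epsilon> / 8 * (\<gamma> / 4)"] \<epsilon> \<gamma> by auto
    \<comment> \<open>The first summand gives \<open>2 * M0 + 2 * (M / 4) \<le> M\<close>, as
      \<open>Q_tau_le\<close> demands; the second makes the noise event \<open>E2\<close> have
      probability at most \<open>\<gamma> / 4\<close>; the third leaves white noise mass at most
      \<open>\<epsilon> / 16\<close> outside the ball.\<close>
    define M where "M = 4 * M0 + 16 * C / \<gamma> + 16 * C / \<epsilon>"
    have M: "M > 0" "M / 4 \<ge> M0" "C / (M / 4) \<le> \<gamma> / 4" "C / M \<le> \<epsilon> / 16"
    proof -
      have pos: "16 * C / \<gamma> \<ge> 0" "16 * C / \<epsilon> \<ge> 0" using C \<epsilon> \<gamma> by auto
      then show "M > 0" "M / 4 \<ge> M0" using M0 by (auto simp: M_def)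
      have "16 * C / \<gamma> \<le> M" "16 * C / \<epsilon> \<le> M" using pos M0 by (auto simp: M_def)
      then show "C / (M / 4) \<le> \<gamma> / 4" "C / M \<le> \<epsilon> / 16"
        using \<epsilon> \<gamma> \<open>M > 0\<close> by (auto simp: field_simps)
    qed
    obtain m where m: "m \<ge> 1" "sqrt (ln (real m + 1) powr (-2 * (\<delta> - \<delta>')) * M) < \<epsilon> / 8"
      using ex_small_log_powr[of "\<delta> - \<delta>'" "\<epsilon> / 8" M] \<delta> \<epsilon> by auto
    let ?tv = "\<lambda>n x. tv_dist (distr (K n x) (borel_V (window m) Z \<psi>) (T_V L Z (window m) Z \<psi> n x))
                    (gaussian_V (window m) Z \<psi>)"
    have "\<forall>l\<in>window m. finite (Z l) \<and> Z l \<subseteq> Z l"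
      by (auto intro: finite_Z dest: windowD)
    from finite_dim[OF window this, unfolded tendsto_zero_in_prob_def, rule_format, of "\<epsilon> / 4"] \<epsilon>
    have "(\<lambda>n. outer_measure_of (?P n) {x \<in> space (?P n). \<epsilon> / 4 < \<bar>?tv n x\<bar>}) \<longlonglongrightarrow> 0"
      by (simp only: half_gt_zero_iff divide_pos_pos zero_less_numeral)
    then have "\<forall>\<^sub>F n in sequentially. outer_measure_of (?P n) {x \<in> space (?P n). \<epsilon> / 4 < \<bar>?tv n x\<bar>} < ennreal (\<gamma> / 4)"
      using \<gamma> by (intro order_tendstoD(2)) auto
    with eventually_ge_at_top[of 1] show ?thesis
    proof eventually_elim
      fix n :: nat assume n: "1 \<le> n"
        and "outer_measure_of (?P n) {x \<in> space (?P n). \<epsilon> / 4 < \<bar>?tv n x\<bar>} < ennreal (\<gamma> / 4)"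
      \<comment> \<open>Outer measure is an infimum over measurable supersets, so the total
        variation event can be enlarged to a measurable one without spoiling the bound.\<close>
      then obtain E3 where E3: "E3 \<in> sets (?P n)" "{x \<in> space (?P n). \<epsilon> / 4 < \<bar>?tv n x\<bar>} \<subseteq> E3"
        "emeasure (?P n) E3 < ennreal (\<gamma> / 4)"
        unfolding outer_measure_of_def INF_less_iff by auto
      \<comment> \<open>Data for which the posterior mass far from \<open>f\<^sub>0\<close> is at
        least \<open>\<epsilon> / 8\<close>, again in the form of Markov's inequality.\<close>
      define E1 where "E1 = {x \<in> space_H L Z a \<delta>. 1 \<le> ennreal (8 / \<epsilon>) * emeasure (K n x) (?F M0 n)}"
      define E2 where "E2 = {x \<in> space_H L Z a \<delta>. ennreal (M / 4) <
        Q \<delta>' (\<lambda>i. sqrt (real n) * (coeffs_L2 L Z \<psi> f\<^sub>0 i - x i))}"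
      have g[measurable]: "(\<lambda>x. emeasure (K n x) (?F M0 n)) \<in> borel_measurable (borel_H L Z a \<delta>)"
        using measurable_compose[OF measurable_prob_algebraD[OF K[OF n]]
            measurable_emeasure_subprob_algebra[OF F_sets]] M0(1) by simp
      have "{x \<in> space (borel_H L Z a \<delta>). 1 \<le> ennreal (8 / \<epsilon>) * emeasure (K n x) (?F M0 n)} \<in> sets (borel_H L Z a \<delta>)"
        by measurable
      then have E1: "E1 \<in> sets (?P n)" by (simp add: E1_def)
      have "emeasure (?P n) E1 \<le> ennreal (8 / \<epsilon>) *
          (\<integral>\<^sup>+x. emeasure (K n x) (?F M0 n) * indicator (space_H L Z a \<delta>) x \<partial>?P n)"
        unfolding E1_def
        by (rule nn_integral_Markov_inequality)
          (use g sets.top[of "borel_H L Z a \<delta>"] in \<open>auto intro!: borel_measurable_times_ennreal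
             simp: measurable_cong_sets[OF sets_data_law refl]\<close>)
      also have "\<dots> \<le> ennreal (8 / \<epsilon>) * ennreal (\<epsilon> / 8 * (\<gamma> / 4))"
        by (intro mult_left_mono order_trans[OF nn_integral_mono M0(2)[OF n]]) (auto simp: indicator_def)
      also have "\<dots> = ennreal (\<gamma> / 4)"
        using \<epsilon> \<gamma> by (subst ennreal_mult[symmetric]) auto
      finally have pE1: "emeasure (?P n) E1 \<le> ennreal (\<gamma> / 4)" .
      have E2: "E2 \<in> sets (?P n)"
        unfolding E2_def using data_law_noise_sets[OF d(1) n] by simp
      have "emeasure (?P n) E2 \<le> ennreal (C / (M / 4))"
        unfolding E2_def using data_law_noise[OF d(1) n] C(2)[of "M / 4"] M(1) by simp
      also have "\<dots> \<le> ennreal (\<gamma> / 4)" using M(3) by (rule ennreal_leI)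
      finally have pE2: "emeasure (?P n) E2 \<le> ennreal (\<gamma> / 4)" .
      have sub: "{x \<in> space (?P n). \<epsilon> < \<bar>?\<beta> n x\<bar>} \<subseteq> E1 \<union> E2 \<union> E3"
      proof
        fix x assume x: "x \<in> {x \<in> space (?P n). \<epsilon> < \<bar>?\<beta> n x\<bar>}"
        then have xH: "x \<in> space_H L Z a \<delta>" by simp
        interpret Kx: prob_space "K n x" by (rule Kx[OF n xH])
        have tau: "(\<lambda>f. tau L Z n x (coeffs_L2 L Z \<psi> f)) \<in> K n x \<rightarrow>\<^sub>M borel_H L Z a \<delta>"
          using measurable_tau[OF d(1) xH] measurable_cong_sets[OF Kx(2)[OF n xH] refl] by blast
        have R: "prob_space (?R n x)" "sets (?R n x) = sets (borel_H L Z a \<delta>)"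
          using Kx.prob_space_distr[OF tau] by auto
        show "x \<in> E1 \<union> E2 \<union> E3"
        proof (rule ccontr)
          assume not: "x \<notin> E1 \<union> E2 \<union> E3"
          have nE2: "Q \<delta>' (\<lambda>i. sqrt (real n) * (coeffs_L2 L Z \<psi> f\<^sub>0 i - x i)) \<le> ennreal (M / 4)"
            using not xH by (auto simp: E2_def)
          let ?A = "{y \<in> space_H L Z a \<delta>. ennreal M < Q \<delta>' y}"
          have A: "?A \<in> sets (borel_H L Z a \<delta>)"
          proof -
            have "{y \<in> space (borel_H L Z a \<delta>). ennreal M < Q \<delta>' y} \<in> sets (borel_H L Z a \<delta>)"
              using measurable_Q_borel_H[measurable] by measurable
            then show ?thesis by simp
          qed
          have "emeasure (?R n x) ?A \<le> emeasure (K n x) (?F M0 n)"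
            unfolding emeasure_distr[OF tau A]
          proof (rule emeasure_mono)
            show "?F M0 n \<in> sets (K n x)" using F_sets M0(1) Kx(2)[OF n xH] by simp
            show "(\<lambda>f. tau L Z n x (coeffs_L2 L Z \<psi> f)) -` ?A \<inter> space (K n x) \<subseteq> ?F M0 n"
            proof safe
              fix f assume f: "ennreal M < Q \<delta>' (tau L Z n x (coeffs_L2 L Z \<psi> f))"
              show "M0 / real n < (norm_H L Z a \<delta>' (coeffs_L2 L Z \<psi> (f - f\<^sub>0)))\<^sup>2"
              proof (rule ccontr)
                assume "\<not> ?thesis"
                then have q: "Q \<delta>' (coeffs_L2 L Z \<psi> (f - f\<^sub>0)) \<le> ennreal (M0 / real n)"
                  using M0(1) d by (simp add: norm_H_coeffs_less_iff not_less)
                have "Q \<delta>' (tau L Z n x (coeffs_L2 L Z \<psi> f)) \<le>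
                    2 * (ennreal (real n) * ennreal (M0 / real n)) + 2 * ennreal (M / 4)"
                  by (rule order_trans[OF Q_tau_le[of _ _ _ _ f\<^sub>0]])
                    (intro add_mono mult_left_mono q nE2; simp)
                also have "\<dots> = ennreal (2 * M0 + 2 * (M / 4))"
                  using n M(1) M0(1)
                  by (simp add: ennreal_mult[symmetric] ennreal_mult[of 2, simplified, symmetric]
                      ennreal_plus[symmetric] del: ennreal_plus)
                also have "\<dots> \<le> ennreal M" using M by (intro ennreal_leI) auto
                finally show False using f by simp
              qed
            qed
          qed
          also have "\<dots> \<le> ennreal (\<epsilon> / 8)"
          proof -
            have "ennreal (8 / \<epsilon>) * emeasure (K n x) (?F M0 n) < 1"
              using not xH by (auto simp: E1_def)
            moreover have "ennreal (8 / \<epsilon>) * emeasure (K n x) (?F M0 n) = ennreal (8 / \<epsilon> * measure (K n x) (?F M0 n))"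
              unfolding Kx.emeasure_eq_measure using \<epsilon> by (intro ennreal_mult[symmetric]) auto
            ultimately have "\<not> 1 \<le> 8 / \<epsilon> * measure (K n x) (?F M0 n)"
              using ennreal_leI[of 1 "8 / \<epsilon> * measure (K n x) (?F M0 n)"] by (auto simp del: ennreal_le_1 simp: not_le[symmetric])
            then have "measure (K n x) (?F M0 n) \<le> \<epsilon> / 8" using \<epsilon> by (simp add: field_simps)
            then show ?thesis by (simp add: Kx.emeasure_eq_measure ennreal_leI)
          qed
          finally have pR: "measure (?R n x) ?A \<le> \<epsilon> / 8"
            using \<epsilon> finite_measure.emeasure_eq_measure[OF prob_space.finite_measure[OF R(1)]] by simp
          have "ennreal (measure ?N ?A) \<le> ennreal (C / M)"
            using C(2)[OF M(1)] finite_measure.emeasure_eq_measure[OF prob_space.finite_measure[OF N]] by simp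
          then have "measure ?N ?A \<le> C / M" using M(1) C(1) by simp
          then have pN: "measure ?N ?A \<le> \<epsilon> / 16" using M(4) by (rule order_trans)
          have "distr (?R n x) (borel_V (window m) Z \<psi>) (proj_V (window m) Z \<psi>) =
              distr (K n x) (borel_V (window m) Z \<psi>) (T_V L Z (window m) Z \<psi> n x)"
            by (subst distr_distr[OF measurable_proj_V tau]) (simp add: comp_def proj_V_tau)
          moreover have "?tv n x \<le> \<epsilon> / 4"
            using not E3(2) x by auto
          \<comment> \<open>The right-hand side is \<open>7 * \<epsilon> / 8\<close>, hence below
            \<open>\<epsilon>\<close>.\<close>
          ultimately have "\<bar>?\<beta> n x\<bar> \<le> 2 * (\<epsilon> / 8) + 2 * (\<epsilon> / 16) + 2 * (\<epsilon> / 8) + \<epsilon> / 4"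
            using beta_H_le[OF R \<delta>(1) d(2) m(1), of M] M(1) pR pN m(2) by simp
          then show False using x \<epsilon> by simp
        qed
      qed
      have "outer_measure_of (?P n) {x \<in> space (?P n). \<epsilon> < \<bar>?\<beta> n x\<bar>} \<le> outer_measure_of (?P n) (E1 \<union> E2 \<union> E3)"
        by (rule outer_measure_of_mono[OF sub])
      also have "\<dots> = emeasure (?P n) (E1 \<union> E2 \<union> E3)"
        using E1 E2 E3(1) by (intro outer_measure_of_eq) blast
      also have "\<dots> \<le> emeasure (?P n) E1 + emeasure (?P n) E2 + emeasure (?P n) E3"
        using E1 E2 E3(1) by (intro order_trans[OF emeasure_subadditive] add_mono emeasure_subadditive) auto
      also have "\<dots> \<le> ennreal (\<gamma> / 4) + ennreal (\<gamma> / 4) + ennreal (\<gamma> / 4)"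
        using pE1 pE2 E3(3) by (intro add_mono) auto
      also have "\<dots> = ennreal (\<gamma> / 4 + \<gamma> / 4 + \<gamma> / 4)"
        using \<gamma> by (simp add: ennreal_plus[symmetric] del: ennreal_plus)
      also have "\<dots> \<le> ennreal \<gamma>" using \<gamma> by (intro ennreal_leI) auto
      finally show "outer_measure_of (?P n) {x \<in> space (?P n). \<epsilon> < \<bar>?\<beta> n x\<bar>} \<le> ennreal \<gamma>" .
    qed
  qed
  show ?thesis
    unfolding tendsto_zero_in_prob_def
  proof (intro allI impI order_tendstoI)
    fix \<epsilon> :: real and y :: ennreal assume \<epsilon>: "\<epsilon> > 0" and "0 < y"
    \<comment> \<open>The bound \<open>y\<close> may be infinite; any \<open>z\<close> strictly
      below it is a finite number, to which \<open>key\<close> applies.\<close>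
    then obtain z where z: "0 < z" "z < y" using dense by blast
    then obtain \<gamma> where "\<gamma> > 0" "z = ennreal \<gamma>" by (cases z) auto
    then show "\<forall>\<^sub>F n in sequentially. outer_measure_of (?P n) {x \<in> space (?P n). \<epsilon> < \<bar>?\<beta> n x\<bar>} < y"
      using key[OF \<epsilon>, of \<gamma>] z by (auto elim!: eventually_mono intro: order.strict_trans1)
  qed simp
qed

end
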